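(* Let $S$ be a separable and complete metric space. QID random measures on $S$ are dense in the space of independently scattered random measures on $S$, considered as random elements in $\mathcal{M}_S$ endowed with the vague topology, under convergence in distribution; that is, for every independently scattered random measure $\xi$ on $S$ there is a sequence $(\xi_n)$ of QID random measures on $S$ with $\xi_n\stackrel{vd}{\to}\xi$.
   Context: Here all (random) measures are non-negative. $\mathbf{S}$ is the Borel $\sigma$-algebra of $S$ and $\hat{\mathbf{S}}$ the ring of bounded Borel sets. $\mathcal{M}_S$ is the space of locally finite measures on $S$ ($\mu(B)<\infty$ for all $B\in\hat{\mathbf{S}}$), with the vague topology, i.e. the coarsest topology making $\mu\mapsto\int f\,d\mu$ continuous for every bounded continuous $f:S\to\mathbb{R}_+$ with bounded support. A random measure $\xi$ on $S$ is a random element of $\mathcal{M}_S$. $\xi_n\stackrel{vd}{\to}\xi$ means $\mathbb{E}[g(\xi_n)]\to\mathbb{E}[g(\xi)]$ for every bounded vaguely continuous $g:\mathcal{M}_S\to\mathbb{R}$. A random measure $\xi$ is independently scattered if $\xi(B_1),\xi(B_2),\dots$ are independent for disjoint $B_1,B_2,\dots\in\hat{\mathbf{S}}$. It is a QID random measure if it is independently scattered and $\xi(B)$ is a QID random variable for every $B\in\hat{\mathbf{S}}$. A real random variable is QID (quasi-infinitely divisible) if its characteristic function is $\exp(i\theta\gamma-\frac{\theta^2}{2}a+\int_{\mathbb{R}}(e^{i\theta x}-1-i\theta\tau(x))\nu(dx))$ with $a,\gamma\in\mathbb{R}$, $\tau(x)=x$ for $|x|\le1$, $\tau(x)=x/|x|$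 for $|x|>1$, and $\nu$ a quasi-Lévy type measure: a real-valued function on the Borel sets $B$ with $0\notin\overline B$, whose restriction to Borel sets disjoint from $(-r,r)$ is a finite signed measure for every $r>0$ and with $\int(1\wedge x^2)|\nu|(dx)<\infty$, where $\nu^+,\nu^-,|\nu|$ are the measures on $\mathcal{B}(\mathbb{R})$ with no mass at $0$ induced by the positive parts, negative parts and total variations of the restrictions, and $\int g\,d\nu=\int g\,d\nu^+-\int g\,d\nu^-$. *)

theory Defs
  imports "HOL-Probability.Probability"
begin

section \<open>Quasi-Levy type measures and QID random variables\<close>

definition finite_signed_measure :: "'a set set \<Rightarrow> ('a set \<Rightarrow> real) \<Rightarrow> bool" where
  "finite_signed_measure \<A> \<nu> \<longleftrightarrow>
     \<nu> {} = 0 \<and>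
     (\<forall>A :: nat \<Rightarrow> 'a set. range A \<subseteq> \<A> \<and> disjoint_family A \<longrightarrow>
        (\<lambda>i. \<nu> (A i)) sums \<nu> (\<Union>i. A i))"

definition borel_off_zero :: "real set set" where
  "borel_off_zero = {B \<in> sets borel. 0 \<notin> closure B}"

text \<open>A quasi-Levy type measure is a function on \<^const>\<open>borel_off_zero\<close>; here it is a total
  function of which no definition below inspects the values outside that domain.

  The positive part of a finite signed measure is \<open>B \<mapsto> sup {\<nu> A | A \<subseteq> B}\<close>. Since \<open>0 \<notin> closure A\<close> iff
  \<open>A\<close> is disjoint from \<open>(-r, r)\<close> for some \<open>r > 0\<close>, the supremum over \<^const>\<open>borel_off_zero\<close> is the
  increasing limit, as \<open>r\<close> decreases to 0, of the positive parts of the restrictions of \<open>\<nu>\<close> to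
  the complements of \<open>(-r, r)\<close>. The empty set contributes 0, and \<^const>\<open>ennreal\<close> sends
  negative numbers to 0.\<close>

definition pos_variation :: "(real set \<Rightarrow> real) \<Rightarrow> real set \<Rightarrow> ennreal" where
  "pos_variation \<nu> B = (SUP A\<in>{A \<in> borel_off_zero. A \<subseteq> B}. ennreal (\<nu> A))"

definition pos_part :: "(real set \<Rightarrow> real) \<Rightarrow> real measure" where
  "pos_part \<nu> = measure_of UNIV (sets borel) (pos_variation \<nu>)"

definition neg_part :: "(real set \<Rightarrow> real) \<Rightarrow> real measure" where
  "neg_part \<nu> = pos_part (\<lambda>B. - \<nu> B)"

definition total_variation :: "(real set \<Rightarrow> real) \<Rightarrow> real measure" where
  "total_variation \<nu> =
     measure_of UNIV (sets borel) (\<lambda>B. emeasure (pos_part \<nu>) B + emeasure (neg_part \<nu>) B)"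

definition quasi_levy_type :: "(real set \<Rightarrow> real) \<Rightarrow> bool" where
  "quasi_levy_type \<nu> \<longleftrightarrow>
     (\<forall>r>0. finite_signed_measure {B \<in> sets borel. B \<inter> {-r<..<r} = {}} \<nu>) \<and>
     (\<integral>\<^sup>+x. ennreal (min 1 (x\<^sup>2)) \<partial>total_variation \<nu>) < \<infinity>"

definition quasi_levy_integral :: "(real set \<Rightarrow> real) \<Rightarrow> (real \<Rightarrow> complex) \<Rightarrow> complex" where
  "quasi_levy_integral \<nu> g = (CLINT x|pos_part \<nu>. g x) - (CLINT x|neg_part \<nu>. g x)"

definition truncation :: "real \<Rightarrow> real" where
  "truncation x = (if \<bar>x\<bar> \<le> 1 then x else x / \<bar>x\<bar>)"

definition qid_variable :: "'w measure \<Rightarrow> ('w \<Rightarrow> real) \<Rightarrow> bool" where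
  "qid_variable P X \<longleftrightarrow>
     prob_space P \<and> X \<in> borel_measurable P \<and>
     (\<exists>(\<gamma>::real) (a::real) \<nu>. quasi_levy_type \<nu> \<and>
        (\<forall>\<theta>::real. char (distr P borel X) \<theta> =
           exp (\<i> * \<theta> * \<gamma> - \<theta>\<^sup>2 / 2 * a +
                quasi_levy_integral \<nu>
                  (\<lambda>x. exp (\<i> * \<theta> * x) - 1 - \<i> * \<theta> * truncation x))))"

section \<open>The vague topology and random measures\<close>

definition bounded_borel :: "'a::polish_space set set" where
  "bounded_borel = {B \<in> sets borel. bounded B}"

definition locally_finite_measures :: "'a::polish_space measure set" where
  "locally_finite_measures =
     {\<mu>. sets \<mu> = sets borel \<and> (\<forall>B\<in>bounded_borel. emeasure \<mu> B < \<infinity>)}"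

definition vague_test_functions :: "('a::polish_space \<Rightarrow> real) set" where
  "vague_test_functions =
     {f. continuous_on UNIV f \<and> (\<forall>x. 0 \<le> f x) \<and> bounded (range f) \<and> bounded {x. f x \<noteq> 0}}"

definition vague_topology :: "'a::polish_space measure topology" where
  "vague_topology = topology_generated_by
     {{\<mu> \<in> locally_finite_measures. (\<integral>x. f x \<partial>\<mu>) \<in> U} | f U. f \<in> vague_test_functions \<and> open U}"

definition vague_borel :: "'a::polish_space measure measure" where
  "vague_borel = sigma (topspace vague_topology) {U. openin vague_topology U}"

definition random_measure :: "'w measure \<Rightarrow> ('w \<Rightarrow> 'a::polish_space measure) \<Rightarrow> bool" where
  "random_measure P \<xi> \<longleftrightarrow> prob_space P \<and> \<xi> \<in> P \<rightarrow>\<^sub>M vague_borel"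

text \<open>Finitely many disjoint sets are covered by taking all but finitely many \<open>B i\<close> empty.\<close>

definition independently_scattered :: "'w measure \<Rightarrow> ('w \<Rightarrow> 'a::polish_space measure) \<Rightarrow> bool" where
  "independently_scattered P \<xi> \<longleftrightarrow>
     random_measure P \<xi> \<and>
     (\<forall>B :: nat \<Rightarrow> 'a set. disjoint_family B \<and> range B \<subseteq> bounded_borel \<longrightarrow>
        prob_space.indep_vars P (\<lambda>_. borel :: real measure) (\<lambda>i \<omega>. measure (\<xi> \<omega>) (B i)) UNIV)"

definition qid_random_measure :: "'w measure \<Rightarrow> ('w \<Rightarrow> 'a::polish_space measure) \<Rightarrow> bool" where
  "qid_random_measure P \<xi> \<longleftrightarrow>
     independently_scattered P \<xi> \<and>
     (\<forall>B\<in>bounded_borel. qid_variable P (\<lambda>\<omega>. measure (\<xi> \<omega>) B))"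

text \<open>The random measures may live on different probability spaces, so each comes with its own.\<close>

definition vd_converges ::
  "(nat \<Rightarrow> 'v measure) \<Rightarrow> (nat \<Rightarrow> 'v \<Rightarrow> 'a::polish_space measure) \<Rightarrow>
   'w measure \<Rightarrow> ('w \<Rightarrow> 'a measure) \<Rightarrow> bool" where
  "vd_converges Q \<eta> P \<xi> \<longleftrightarrow>
     (\<forall>g :: 'a measure \<Rightarrow> real.
        continuous_map vague_topology euclideanreal g \<and> bounded (g ` topspace vague_topology) \<longrightarrow>
        (\<lambda>n. \<integral>\<omega>. g (\<eta> n \<omega>) \<partial>Q n) \<longlonglongrightarrow> (\<integral>\<omega>. g (\<xi> \<omega>) \<partial>P))"

section \<open>Sanity checks\<close>

lemma borel_off_zero_iff:
  "A \<in> borel_off_zero \<longleftrightarrow> A \<in> sets borel \<and> (\<exists>r>0. A \<inter> {-r<..<r} = {})"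
proof -
  have "0 \<notin> closure A \<longleftrightarrow> (\<exists>r>0. A \<inter> {-r<..<r} = {})"
    unfolding closure_approachable
    by (fastforce simp: dist_real_def abs_less_iff not_less)
  then show ?thesis by (auto simp: borel_off_zero_def)
qed

lemma pos_variation_sigma_additive:
  assumes "\<forall>r>0. finite_signed_measure {B \<in> sets borel. B \<inter> {-r<..<r} = {}} \<nu>"
  shows "positive (sets borel) (pos_variation \<nu>)"
    and "countably_additive (sets borel) (pos_variation \<nu>)"
proof -
  have e: "\<nu> {} = 0"
    using assms[rule_format, of 1] by (auto simp: finite_signed_measure_def)
  have off_empty: "{} \<in> borel_off_zero" by (auto simp: borel_off_zero_def)
  have off_Int: "A \<inter> B \<in> borel_off_zero" if "A \<in> borel_off_zero" "B \<in> sets borel" for A B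
    using that unfolding borel_off_zero_iff by blast
  have off_Un: "A \<union> B \<in> borel_off_zero" if "A \<in> borel_off_zero" "B \<in> borel_off_zero" for A B
    using that by (auto simp: borel_off_zero_def)
  have sums: "(\<lambda>i. \<nu> (A i)) sums \<nu> (\<Union>i. A i)"
    if d: "disjoint_family A" "range A \<subseteq> sets borel" "(\<Union>i. A i) \<in> borel_off_zero"
    for A :: "nat \<Rightarrow> real set"
  proof -
    obtain r where r: "r > 0" "(\<Union>i. A i) \<inter> {-r<..<r} = {}"
      using d(3) by (auto simp: borel_off_zero_iff)
    then have "range A \<subseteq> {B \<in> sets borel. B \<inter> {-r<..<r} = {}}" using d(2) by blast
    with assms r(1) d(1) show ?thesis unfolding finite_signed_measure_def by blast
  qed
  have add: "\<nu> (A \<union> B) = \<nu> A + \<nu> B"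
    if "A \<in> borel_off_zero" "B \<in> borel_off_zero" "A \<inter> B = {}" for A B
  proof -
    let ?F = "\<lambda>i::nat. if i = 0 then A else if i = 1 then B else {}"
    have U: "(\<Union>i. ?F i) = A \<union> B" by (auto split: if_splits)
    have "(\<lambda>i. \<nu> (?F i)) sums \<nu> (\<Union>i. ?F i)"
    proof (rule sums)
      show "disjoint_family ?F" using that(3) by (auto simp: disjoint_family_on_def)
      show "range ?F \<subseteq> sets borel" using that by (auto simp: borel_off_zero_def)
      show "(\<Union>i. ?F i) \<in> borel_off_zero" unfolding U by (rule off_Un) (use that in auto)
    qed
    moreover have "(\<lambda>i. \<nu> (?F i)) sums (\<Sum>i\<in>{0,1}. \<nu> (?F i))"
      by (rule sums_finite) (auto simp: e)
    ultimately have "\<nu> (\<Union>i. ?F i) = (\<Sum>i\<in>{0,1}. \<nu> (?F i))" by (rule sums_unique2)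
    then show ?thesis unfolding U by simp
  qed
  have mono: "pos_variation \<nu> A \<le> pos_variation \<nu> B" if "A \<subseteq> B" for A B
    unfolding pos_variation_def by (rule SUP_subset_mono) (use that in auto)
  have pv_empty: "pos_variation \<nu> {} = 0"
  proof -
    have "{A \<in> borel_off_zero. A \<subseteq> {}} = {{}}" using off_empty by auto
    then show ?thesis by (simp add: pos_variation_def e)
  qed
  then show "positive (sets borel) (pos_variation \<nu>)" by (simp add: positive_def)
  have super: "pos_variation \<nu> A + pos_variation \<nu> B \<le> pos_variation \<nu> (A \<union> B)"
    if disj: "A \<inter> B = {}" for A B
  proof -
    have *: "ennreal (\<nu> C) + ennreal (\<nu> D) \<le> pos_variation \<nu> (A \<union> B)"
      if C: "C \<in> borel_off_zero" "C \<subseteq> A" and D: "D \<in> borel_off_zero" "D \<subseteq> B" for C D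
    proof -
      have up: "ennreal (\<nu> E) \<le> pos_variation \<nu> (A \<union> B)"
        if "E \<in> borel_off_zero" "E \<subseteq> A \<union> B" for E
        unfolding pos_variation_def by (rule SUP_upper) (use that in auto)
      consider "\<nu> C \<le> 0" | "\<nu> D \<le> 0" | "\<nu> C \<ge> 0" "\<nu> D \<ge> 0" by linarith
      then show ?thesis
      proof cases
        case 1
        then show ?thesis using up[of D] D by (auto simp: ennreal_neg)
      next
        case 2
        then show ?thesis using up[of C] C by (auto simp: ennreal_neg)
      next
        case 3
        have "C \<inter> D = {}" using C D disj by blast
        then have "ennreal (\<nu> C) + ennreal (\<nu> D) = ennreal (\<nu> (C \<union> D))"
          using add[of C D] C D 3 by simp
        also have "\<dots> \<le> pos_variation \<nu> (A \<union> B)"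
          using up[of "C \<union> D"] off_Un[of C D] C D by blast
        finally show ?thesis .
      qed
    qed
    have neA: "{C \<in> borel_off_zero. C \<subseteq> A} \<noteq> {}" for A using off_empty by blast
    have "pos_variation \<nu> A + pos_variation \<nu> B =
      (SUP C\<in>{C \<in> borel_off_zero. C \<subseteq> A}. ennreal (\<nu> C) + pos_variation \<nu> B)"
      unfolding pos_variation_def[of \<nu> A]
      by (rule ennreal_SUP_add_left[symmetric]) (rule neA)
    also have "\<dots> = (SUP C\<in>{C \<in> borel_off_zero. C \<subseteq> A}.
      SUP D\<in>{D \<in> borel_off_zero. D \<subseteq> B}. ennreal (\<nu> C) + ennreal (\<nu> D))"
      unfolding pos_variation_def[of \<nu> B]
      by (subst ennreal_SUP_add_right[OF neA]) (rule refl)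
    also have "\<dots> \<le> pos_variation \<nu> (A \<union> B)"
      by (intro SUP_least) (use * in auto)
    finally show ?thesis .
  qed
  show "countably_additive (sets borel) (pos_variation \<nu>)"
  proof (rule countably_additiveI)
    fix A :: "nat \<Rightarrow> real set"
    assume A: "range A \<subseteq> sets borel" "disjoint_family A" "(\<Union>i. A i) \<in> sets borel"
    show "(\<Sum>i. pos_variation \<nu> (A i)) = pos_variation \<nu> (\<Union>i. A i)"
    proof (rule antisym)
      have fin: "(\<Sum>i<n. pos_variation \<nu> (A i)) \<le> pos_variation \<nu> (\<Union>i<n. A i)" for n
      proof (induction n)
        case (Suc n)
        have d: "(\<Union>i<n. A i) \<inter> A n = {}"
        proof -
          have "A i \<inter> A n = {}" if "i < n" for i
            using A(2) that unfolding disjoint_family_on_def by (metis UNIV_I less_irrefl)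
          then show ?thesis by blast
        qed
        have "(\<Sum>i<Suc n. pos_variation \<nu> (A i)) \<le>
          pos_variation \<nu> (\<Union>i<n. A i) + pos_variation \<nu> (A n)"
          using Suc by (simp add: add_right_mono)
        also have "\<dots> \<le> pos_variation \<nu> ((\<Union>i<n. A i) \<union> A n)" by (rule super[OF d])
        also have "(\<Union>i<n. A i) \<union> A n = (\<Union>i<Suc n. A i)" by (auto simp: less_Suc_eq)
        finally show ?case .
      qed (simp add: pv_empty)
      show "(\<Sum>i. pos_variation \<nu> (A i)) \<le> pos_variation \<nu> (\<Union>i. A i)"
        unfolding suminf_eq_SUP
        by (intro SUP_least order_trans[OF fin] mono) auto
      show "pos_variation \<nu> (\<Union>i. A i) \<le> (\<Sum>i. pos_variation \<nu> (A i))"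
        unfolding pos_variation_def[of \<nu> "\<Union>i. A i"]
      proof (rule SUP_least, clarsimp)
        fix C assume C: "C \<in> borel_off_zero" "C \<subseteq> (\<Union>i. A i)"
        let ?S = "\<Sum>i. pos_variation \<nu> (A i)"
        have U: "(\<Union>i. C \<inter> A i) = C" using C(2) by blast
        have "(\<lambda>i. \<nu> (C \<inter> A i)) sums \<nu> (\<Union>i. C \<inter> A i)"
        proof (rule sums)
          show "disjoint_family (\<lambda>i. C \<inter> A i)"
            using A(2) by (auto simp: disjoint_family_on_def)
          show "range (\<lambda>i. C \<inter> A i) \<subseteq> sets borel"
            using A(1) C(1) by (auto simp: borel_off_zero_def)
          show "(\<Union>i. C \<inter> A i) \<in> borel_off_zero" unfolding U by (rule C(1))
        qed
        then have lim: "(\<lambda>n. \<Sum>i<n. \<nu> (C \<inter> A i)) \<longlonglongrightarrow> \<nu> C" unfolding U sums_def .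
        have "ennreal (\<Sum>i<n. \<nu> (C \<inter> A i)) \<le> ?S" for n
        proof -
          have "ennreal (\<Sum>i<n. \<nu> (C \<inter> A i)) \<le> ennreal (\<Sum>i<n. max 0 (\<nu> (C \<inter> A i)))"
            by (intro ennreal_leI sum_mono) auto
          also have "\<dots> = (\<Sum>i<n. ennreal (max 0 (\<nu> (C \<inter> A i))))"
            by (rule sum_ennreal[symmetric]) simp
          also have "\<dots> = (\<Sum>i<n. ennreal (\<nu> (C \<inter> A i)))"
            by (intro sum.cong refl) (simp add: max_def ennreal_neg)
          also have "\<dots> \<le> (\<Sum>i<n. pos_variation \<nu> (A i))"
            unfolding pos_variation_def
            using A(1) by (intro sum_mono SUP_upper) (auto intro!: off_Int C(1))
          also have "\<dots> \<le> ?S" by (rule sum_le_suminf) auto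
          finally show ?thesis .
        qed
        then show "ennreal (\<nu> C) \<le> ?S"
          using tendsto_ennrealI[OF lim] by (intro LIMSEQ_le_const2) auto
      qed
    qed
  qed
qed

lemma emeasure_pos_part:
  assumes "\<forall>r>0. finite_signed_measure {B \<in> sets borel. B \<inter> {-r<..<r} = {}} \<nu>"
    and "B \<in> sets borel"
  shows "emeasure (pos_part \<nu>) B = pos_variation \<nu> B"
  unfolding pos_part_def using assms(2)
  by (intro emeasure_measure_of_sigma pos_variation_sigma_additive assms(1))
     (auto simp: sets.sigma_algebra_axioms[of borel, simplified])

lemma emeasure_total_variation:
  assumes "B \<in> sets borel"
  shows "emeasure (total_variation \<nu>) B = emeasure (pos_part \<nu>) B + emeasure (neg_part \<nu>) B"
proof -
  have s: "sets (pos_part \<nu>) = sets borel" for \<nu>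
    unfolding pos_part_def using sets.sigma_sets_eq[of "borel :: real measure"] by (simp add: sets_measure_of)
  have "countably_additive (sets borel) (\<lambda>B. emeasure (pos_part \<nu>) B + emeasure (neg_part \<nu>) B)"
  proof (rule countably_additiveI)
    fix A :: "nat \<Rightarrow> real set"
    assume A: "range A \<subseteq> sets borel" "disjoint_family A"
    have "(\<Sum>i. emeasure (pos_part \<mu>) (A i)) = emeasure (pos_part \<mu>) (\<Union>i. A i)" for \<mu>
      using A by (intro suminf_emeasure) (simp_all add: s)
    then show "(\<Sum>i. emeasure (pos_part \<nu>) (A i) + emeasure (neg_part \<nu>) (A i)) =
      emeasure (pos_part \<nu>) (\<Union>i. A i) + emeasure (neg_part \<nu>) (\<Union>i. A i)"
      unfolding neg_part_def by (subst suminf_add[symmetric]) simp_all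
  qed
  then show ?thesis
    unfolding total_variation_def using assms
    by (intro emeasure_measure_of_sigma)
       (auto simp: sets.sigma_algebra_axioms[of borel, simplified] positive_def)
qed

lemma topspace_vague_topology: "topspace vague_topology = locally_finite_measures"
proof -
  have "(\<lambda>_. 0) \<in> vague_test_functions" by (simp add: vague_test_functions_def)
  then have "locally_finite_measures \<in>
    {{\<mu> \<in> locally_finite_measures. (\<integral>x. f x \<partial>\<mu>) \<in> U} | f U. f \<in> vague_test_functions \<and> open U}"
    by (intro CollectI exI[of _ "\<lambda>_. 0"] exI[of _ UNIV]) auto
  then show ?thesis unfolding vague_topology_def by auto
qed

lemma continuous_map_vague_integral:
  assumes "f \<in> vague_test_functions"
  shows "continuous_map vague_topology euclideanreal (\<lambda>\<mu>. \<integral>x. f x \<partial>\<mu>)"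
  unfolding continuous_map_def topspace_vague_topology
proof (intro conjI allI impI)
  fix U :: "real set" assume "openin euclideanreal U"
  then show "openin vague_topology {\<mu> \<in> locally_finite_measures. (\<integral>x. f x \<partial>\<mu>) \<in> U}"
    unfolding vague_topology_def using assms by (intro topology_generated_by_Basis) auto
qed simp

end

theory Submission
  imports Defs "HOL-Computational_Algebra.Fundamental_Theorem_Algebra"
begin

text \<open>An independently scattered random measure is a limit of random measures with finitely many
  independent atoms at fixed points, and the masses of these atoms can be made QID by a small
  change of their laws.

  Fix a dense sequence \<open>d\<close>. At stage \<open>n\<close>, move the mass that \<open>\<mu>\<close> places near each of \<open>d 0, \<dots>, d n\<close>
  onto that point and round it down to a multiple of \<open>2\<^sup>-\<^sup>n\<close>, at most \<open>n\<close> (\<open>quantized_mass\<close>). This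
  converges vaguely for every single locally finite \<open>\<mu>\<close> (\<open>quantized_mass_limitin\<close>), so for \<open>\<mu> = \<xi>
  \<omega>\<close> dominated convergence gives convergence in distribution. The cells being disjoint, the masses
  of the atoms are independent, and each of them has a law on a finite piece of a lattice.

  A law on a finite piece of a lattice is QID as soon as its generating polynomial \<open>p\<close> has no root
  on the unit circle (\<open>qid_variable_lattice\<close>): every linear factor of \<open>p\<close> then has a logarithm
  that is an absolutely convergent Laurent series on the circle, and the coefficients of the sum
  of these logarithms are the weights of \<open>\<nu>\<close>. Replacing the weights \<open>p\<^sub>k\<close> by multiples of \<open>p\<^sub>k
  r\<^sup>k\<close> moves the moduli of the roots, so that all but finitely many \<open>r\<close> near 1 avoid the circle
  (\<open>exponential_tilt_approximation\<close>). At stage \<open>n\<close> the joint law of the atoms moves by less than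
  \<open>1 / (n + 1)\<close> in \<open>\<ell>\<^sup>1\<close>, so \<open>E g\<close> moves by at most \<open>sup \<bar>g\<bar> / (n + 1)\<close>, for all bounded \<open>g\<close> at
  once. Hence one sequence serves every \<open>g\<close>. Since the new laws have finite support, \<open>Q n\<close> may be
  taken discrete, and every map on it is measurable.\<close>

section \<open>Exponentials of absolutely convergent Laurent series on the unit circle\<close>

(* Leaves the reading as integrability for the counting measure, to which infsetsum belongs. *)
no_notation Infinite_Sum.abs_summable_on (infixr \<open>abs'_summable'_on\<close> 46)

text \<open>Subtracting 1 from each power makes every exponent vanish at \<open>z = 1\<close>, the normalization of a
  characteristic function at 0. With \<open>z = exp (\<i> h \<theta>)\<close> and \<open>c k \<ge> 0\<close>, the \<open>k\<close>-th term is the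
  exponent of \<open>h k\<close> times a Poisson variable of mean \<open>c k\<close>; other coefficients extend this
  formally.\<close>

definition circle_exponential :: "(complex \<Rightarrow> complex) \<Rightarrow> bool" where
  "circle_exponential F \<longleftrightarrow>
     (\<exists>(m::int) (c::int \<Rightarrow> complex). c abs_summable_on UNIV \<and>
        (\<forall>z. norm z = 1 \<longrightarrow> F z = z powi m * exp (\<Sum>\<^sub>ak. c k * (z powi k - 1))))"

lemma norm_powi_minus_one_le: 
  fixes z :: complex
  assumes "norm z = 1" shows "norm (z powi k - 1) \<le> 2"
proof -
  have "norm (z powi k - 1) \<le> norm (z powi k) + norm (1::complex)" by (rule norm_triangle_ineq4)
  then show ?thesis using assms by (simp add: norm_power_int)
qed

lemma abs_summable_circle_exponent:
  fixes c :: "int \<Rightarrow> complex"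
  assumes "c abs_summable_on UNIV" "norm z = 1"
  shows "(\<lambda>k. c k * (z powi k - 1)) abs_summable_on UNIV"
proof (rule abs_summable_on_comparison_test')
  show "(\<lambda>k. 2 * norm (c k)) abs_summable_on UNIV"
    using assms(1) by (intro abs_summable_on_cmult_right) simp
  show "norm (c k * (z powi k - 1)) \<le> 2 * norm (c k)" for k
    using mult_left_mono[OF norm_powi_minus_one_le[OF assms(2), of k], of "norm (c k)"]
    by (simp add: norm_mult mult.commute)
qed

lemma circle_exponential_mult:
  assumes "circle_exponential F" "circle_exponential G"
  shows "circle_exponential (\<lambda>z. F z * G z)"
proof -
  obtain m c where c: "c abs_summable_on UNIV"
    "\<And>z. norm z = 1 \<Longrightarrow> F z = z powi m * exp (\<Sum>\<^sub>ak. c k * (z powi k - 1))"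
    using assms(1) unfolding circle_exponential_def by blast
  obtain n d where d: "d abs_summable_on UNIV"
    "\<And>z. norm z = 1 \<Longrightarrow> G z = z powi n * exp (\<Sum>\<^sub>ak. d k * (z powi k - 1))"
    using assms(2) unfolding circle_exponential_def by blast
  have "F z * G z = z powi (m + n) * exp (\<Sum>\<^sub>ak. (c k + d k) * (z powi k - 1))" if z: "norm z = 1" for z
  proof -
    have "(\<Sum>\<^sub>ak. (c k + d k) * (z powi k - 1)) =
        (\<Sum>\<^sub>ak. c k * (z powi k - 1)) + (\<Sum>\<^sub>ak. d k * (z powi k - 1))"
      using infsetsum_add[OF abs_summable_circle_exponent[OF c(1) z] abs_summable_circle_exponent[OF d(1) z]]
      by (simp add: distrib_right)
    moreover have "z \<noteq> 0" using z by auto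
    ultimately show ?thesis using c(2)[OF z] d(2)[OF z]
      by (simp add: exp_add power_int_add)
  qed
  with c(1) d(1) show ?thesis unfolding circle_exponential_def
    by (intro exI[of _ "m + n"] exI[of _ "\<lambda>k. c k + d k"]) auto
qed

lemma infsetsum_supported_on_range:
  fixes f :: "int \<Rightarrow> 'b::{banach,second_countable_topology}" and e :: "nat \<Rightarrow> int"
  assumes "inj e" "\<And>k. k \<notin> range e \<Longrightarrow> f k = 0"
  shows "f abs_summable_on UNIV \<longleftrightarrow> (\<lambda>n. f (e n)) abs_summable_on UNIV"
    and "infsetsum f UNIV = (\<Sum>\<^sub>an. f (e n))"
proof -
  have "f abs_summable_on UNIV \<longleftrightarrow> f abs_summable_on range e"
    by (rule abs_summable_on_cong_neutral) (use assms in auto)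
  also have "\<dots> \<longleftrightarrow> (\<lambda>n. f (e n)) abs_summable_on UNIV"
    using abs_summable_on_reindex_iff[OF assms(1), of f] by simp
  finally show "f abs_summable_on UNIV \<longleftrightarrow> (\<lambda>n. f (e n)) abs_summable_on UNIV" .
  have "infsetsum f UNIV = infsetsum f (range e)"
    by (rule infsetsum_cong_neutral) (use assms in auto)
  also have "\<dots> = (\<Sum>\<^sub>an. f (e n))"
    using assms(1) by (rule infsetsum_reindex)
  finally show "infsetsum f UNIV = (\<Sum>\<^sub>an. f (e n))" .
qed

lemma exp_infsetsum_log_series:
  fixes w :: complex
  assumes "norm w < 1"
  shows "(\<lambda>n. - (w ^ n) / of_nat n) abs_summable_on (UNIV :: nat set)"
    and "exp (\<Sum>\<^sub>an. - (w ^ n) / of_nat n) = 1 - w"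
proof -
  show *: "(\<lambda>n. - (w ^ n) / of_nat n) abs_summable_on (UNIV :: nat set)"
  proof (rule abs_summable_on_comparison_test')
    show "(\<lambda>n. norm w ^ n) abs_summable_on UNIV"
      using assms by (simp add: abs_summable_on_nat_iff')
    show "norm (- (w ^ n) / of_nat n) \<le> norm w ^ n" for n
    proof (cases n)
      case (Suc m)
      have "norm w ^ n / real n \<le> norm w ^ n / 1"
        using Suc by (intro divide_left_mono) auto
      then show ?thesis by (simp add: norm_divide norm_power)
    qed simp
  qed
  have "(\<lambda>n. - (w ^ n) / of_nat n) sums Ln (1 - w)"
    using Ln_series'[of "- w"] assms by simp
  with sums_infsetsum_nat'[OF *] have "(\<Sum>\<^sub>an. - (w ^ n) / of_nat n) = Ln (1 - w)"
    by (rule sums_unique2)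
  moreover have "1 - w \<noteq> 0" using assms by auto
  ultimately show "exp (\<Sum>\<^sub>an. - (w ^ n) / of_nat n) = 1 - w" by simp
qed

text \<open>The logarithm of \<open>1 - a z\<^sup>s\<close> is a power series in \<open>z\<^sup>s\<close>, which converges absolutely on the
  circle because \<open>\<bar>a\<bar> < 1\<close>. The two values of \<open>s\<close> serve the roots outside and inside the circle.\<close>

lemma circle_exponential_one_minus:
  fixes a :: complex and s :: int
  assumes a: "norm a < 1" and s: "\<bar>s\<bar> = 1"
  shows "circle_exponential (\<lambda>z. (1 - a * z powi s) / (1 - a))"
proof -
  define e :: "nat \<Rightarrow> int" where "e n = s * int n" for n
  have s0: "s \<noteq> 0" using s by auto
  have e: "inj e" using s0 by (auto simp: e_def inj_on_def)
  define c where "c k = (if k \<in> range e then - (a ^ nat (s * k)) / of_nat (nat (s * k)) else 0)" for k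
  have se: "nat (s * e n) = n" for n
  proof -
    have "s * e n = (s * s) * int n" by (simp add: e_def)
    moreover have "s * s = 1" using s by (auto simp: abs_if split: if_splits)
    ultimately show ?thesis by simp
  qed
  have ce: "c (e n) = - (a ^ n) / of_nat n" for n by (simp add: c_def se)
  have c0: "c k = 0" if "k \<notin> range e" for k using that by (simp add: c_def)
  have c: "c abs_summable_on UNIV"
    using infsetsum_supported_on_range(1)[OF e, of c] c0 exp_infsetsum_log_series(1)[OF a] by (simp add: ce)
  have "(1 - a * z powi s) / (1 - a) = z powi 0 * exp (\<Sum>\<^sub>ak. c k * (z powi k - 1))" if z: "norm z = 1" for z
  proof -
    have az: "norm (a * z powi s) < 1" using a z by (simp add: norm_mult norm_power_int)
    have "(\<Sum>\<^sub>ak. c k * (z powi k - 1)) = (\<Sum>\<^sub>an. c (e n) * (z powi e n - 1))"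
      by (rule infsetsum_supported_on_range(2)[OF e]) (simp add: c0)
    also have "\<dots> = (\<Sum>\<^sub>an. - ((a * z powi s) ^ n) / of_nat n - (- (a ^ n) / of_nat n))"
    proof (rule infsetsum_cong)
      fix n
      have "z powi e n = (z powi s) ^ n" by (simp add: e_def power_int_mult)
      then show "c (e n) * (z powi e n - 1) = - ((a * z powi s) ^ n) / of_nat n - (- (a ^ n) / of_nat n)"
        by (simp add: ce power_mult_distrib right_diff_distrib)
    qed simp
    also have "\<dots> = (\<Sum>\<^sub>an. - ((a * z powi s) ^ n) / of_nat n) - (\<Sum>\<^sub>an. - (a ^ n) / of_nat n)"
      by (rule infsetsum_diff) (use exp_infsetsum_log_series(1) a az in auto)
    finally show ?thesis
      by (simp only: exp_diff exp_infsetsum_log_series(2)[OF a] exp_infsetsum_log_series(2)[OF az] power_int_0_right mult_1_left)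
  qed
  with c show ?thesis unfolding circle_exponential_def by blast
qed

lemma circle_exponential_cong:
  assumes "circle_exponential F" "\<And>z. norm z = 1 \<Longrightarrow> F z = G z"
  shows "circle_exponential G"
  using assms unfolding circle_exponential_def by metis

lemma circle_exponential_monomial: "circle_exponential (\<lambda>z. z)"
  unfolding circle_exponential_def by (intro exI[of _ 1] exI[of _ "\<lambda>_. 0"]) simp

text \<open>A root inside the circle is turned into one outside by taking out the factor \<open>z\<close>: \<open>z - b = z
  (1 - b / z)\<close>. This is where the winding number \<open>m\<close> comes from.\<close>

lemma circle_exponential_linear:
  assumes "norm b \<noteq> 1"
  shows "circle_exponential (\<lambda>z. (z - b) / (1 - b))"
proof (cases "norm b < 1")
  case True
  have "circle_exponential (\<lambda>z. z * ((1 - b * z powi -1) / (1 - b)))"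
    by (intro circle_exponential_mult circle_exponential_monomial circle_exponential_one_minus True) simp
  then show ?thesis
  proof (rule circle_exponential_cong)
    fix z :: complex assume "norm z = 1"
    then have "z \<noteq> 0" by auto
    then show "z * ((1 - b * z powi -1) / (1 - b)) = (z - b) / (1 - b)"
      by (simp add: power_int_minus right_diff_distrib)
  qed
next
  case False
  then have "norm b > 1" using assms by simp
  then have b: "norm (1 / b) < 1" "b \<noteq> 0" "b \<noteq> 1" by (auto simp: norm_divide divide_simps)
  have "circle_exponential (\<lambda>z. (1 - 1 / b * z powi 1) / (1 - 1 / b))"
    by (intro circle_exponential_one_minus b) simp
  then show ?thesis
  proof (rule circle_exponential_cong)
    fix z :: complex 
    show "(1 - 1 / b * z powi 1) / (1 - 1 / b) = (z - b) / (1 - b)"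
      using b by (simp add: divide_simps) (simp add: algebra_simps)
  qed
qed

lemma circle_exponential_poly:
  fixes p :: "complex poly"
  assumes "\<And>z. norm z = 1 \<Longrightarrow> poly p z \<noteq> 0"
  shows "circle_exponential (\<lambda>z. poly p z / poly p 1)"
  using assms
proof (induction "degree p" arbitrary: p)
  case 0
  then obtain a where "p = [:a:]" by (metis degree_eq_zeroE)
  with 0(2)[of 1] show ?case unfolding circle_exponential_def
    by (intro exI[of _ 0] exI[of _ "\<lambda>_. 0"]) simp
next
  case (Suc n)
  then have "\<not> constant (poly p)" by (simp add: constant_degree)
  then obtain b where "poly p b = 0" using fundamental_theorem_of_algebra by blast
  then obtain q where p: "p = [:- b, 1:] * q" by (auto simp: poly_eq_0_iff_dvd)
  have b: "norm b \<noteq> 1" using Suc(3)[of b] p by auto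
  have q: "poly q z \<noteq> 0" if "norm z = 1" for z using Suc(3)[OF that] p by auto
  then have "q \<noteq> 0" using norm_one by fastforce
  then have "degree q = n" using Suc(2) p by (simp add: degree_mult_eq del: mult_pCons_left)
  then have "circle_exponential (\<lambda>z. (z - b) / (1 - b) * (poly q z / poly q 1))"
    using Suc(1)[of q] q by (intro circle_exponential_mult circle_exponential_linear b) auto
  then show ?case by (rule circle_exponential_cong) (simp add: p algebra_simps)
qed

lemma continuous_on_circle_exponent:
  fixes c :: "int \<Rightarrow> complex"
  assumes c: "c abs_summable_on UNIV"
  shows "continuous_on UNIV (\<lambda>t. \<Sum>\<^sub>ak. c k * (cis t powi k - 1))"
proof (rule continuous_on_sequentiallyI)
  fix u :: "nat \<Rightarrow> real" and a
  assume u: "u \<longlonglongrightarrow> a"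
  show "(\<lambda>n. \<Sum>\<^sub>ak. c k * (cis (u n) powi k - 1)) \<longlonglongrightarrow> (\<Sum>\<^sub>ak. c k * (cis a powi k - 1))"
    unfolding infsetsum_def
  proof (rule integral_dominated_convergence)
    show "integrable (count_space UNIV) (\<lambda>k. 2 * norm (c k))"
      using c by (simp add: abs_summable_on_def)
    show "AE k in count_space UNIV. (\<lambda>n. c k * (cis (u n) powi k - 1)) \<longlonglongrightarrow> c k * (cis a powi k - 1)"
      by (intro always_eventually allI tendsto_intros tendsto_power_int tendsto_cis u) auto
    show "AE k in count_space UNIV. norm (c k * (cis (u n) powi k - 1)) \<le> 2 * norm (c k)" for n
      using mult_left_mono[OF norm_powi_minus_one_le[of "cis (u n)"], of "norm (c k)" for k]
      by (auto simp: norm_mult mult.commute)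
  qed auto
qed

text \<open>Write the exponent as \<open>R + \<i> I\<close>, where the series \<open>R\<close> and \<open>I\<close> have the real and the
  imaginary parts of the coefficients. Conjugation symmetry of \<open>F\<close> gives the same representation
  with \<open>R - \<i> I\<close>, so \<open>exp (\<i> I)\<close> only takes the values 1 and -1. It is continuous on the line and
  equals 1 at 0, so it is constantly 1.\<close>

lemma real_circle_exponent:
  assumes F: "circle_exponential F"
    and sym: "\<And>z. norm z = 1 \<Longrightarrow> F (cnj z) = cnj (F z)"
  obtains m :: int and c :: "int \<Rightarrow> real" where "c abs_summable_on UNIV"
    "\<And>t. F (cis t) = cis t powi m * exp (\<Sum>\<^sub>ak. complex_of_real (c k) * (cis t powi k - 1))"
proof -
  obtain m d where d: "d abs_summable_on UNIV"
    and F: "\<And>z. norm z = 1 \<Longrightarrow> F z = z powi m * exp (\<Sum>\<^sub>ak. d k * (z powi k - 1))"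
    using F unfolding circle_exponential_def by blast
  let ?E = "\<lambda>t. \<Sum>\<^sub>ak. d k * (cis t powi k - 1)"
  let ?C = "\<lambda>t. \<Sum>\<^sub>ak. cnj (d k) * (cis t powi k - 1)"
  let ?R = "\<lambda>t. \<Sum>\<^sub>ak. complex_of_real (Re (d k)) * (cis t powi k - 1)"
  let ?I = "\<lambda>t. \<Sum>\<^sub>ak. complex_of_real (Im (d k)) * (cis t powi k - 1)"
  have R: "(\<lambda>k. complex_of_real (Re (d k))) abs_summable_on UNIV"
    and I: "(\<lambda>k. complex_of_real (Im (d k))) abs_summable_on UNIV"
    using d abs_summable_Re abs_summable_Im by auto
  have "?E t = (\<Sum>\<^sub>ak. complex_of_real (Re (d k)) * (cis t powi k - 1) + \<i> * (complex_of_real (Im (d k)) * (cis t powi k - 1)))" for t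
    by (rule infsetsum_cong) (auto simp: algebra_simps complex_eq_iff)
  then have E: "?E t = ?R t + \<i> * ?I t" for t
    using abs_summable_circle_exponent[OF R, of "cis t"] abs_summable_circle_exponent[OF I, of "cis t"]
    by (simp add: infsetsum_add infsetsum_cmult_right abs_summable_on_cmult_right)
  have "?C t = (\<Sum>\<^sub>ak. complex_of_real (Re (d k)) * (cis t powi k - 1) - \<i> * (complex_of_real (Im (d k)) * (cis t powi k - 1)))" for t
    by (rule infsetsum_cong) (auto simp: algebra_simps complex_eq_iff)
  then have C: "?C t = ?R t - \<i> * ?I t" for t
    using abs_summable_circle_exponent[OF R, of "cis t"] abs_summable_circle_exponent[OF I, of "cis t"]
    by (simp add: infsetsum_diff infsetsum_cmult_right abs_summable_on_cmult_right)
  have Fc: "F (cis t) = cis t powi m * exp (?C t)" for t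
  proof -
    have "F (cis t) = cnj (F (cis (- t)))" using sym[of "cis (- t)"] by (simp add: cis_cnj)
    also have "\<dots> = cis t powi m * exp (cnj (?E (- t)))"
      by (subst F) (simp_all add: cis_cnj exp_cnj)
    also have "cnj (?E (- t)) = ?C t"
      unfolding infsetsum_def Bochner_Integration.integral_cnj[symmetric] by (simp add: cis_cnj)
    finally show ?thesis .
  qed
  have one: "exp (\<i> * ?I t) ^ 2 = 1" for t
  proof -
    have "cis t powi m * exp (?E t) = cis t powi m * exp (?C t)"
      using F[of "cis t"] Fc[of t] by simp
    then have "exp (?R t + \<i> * ?I t) = exp (?R t - \<i> * ?I t)" unfolding E C by simp
    then show ?thesis by (simp add: exp_add exp_diff power2_eq_square field_simps)
  qed
  have "(\<lambda>t. exp (\<i> * ?I t)) constant_on UNIV"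
  proof (rule continuous_finite_range_constant)
    show "continuous_on UNIV (\<lambda>t. exp (\<i> * ?I t))"
      by (intro continuous_intros continuous_on_circle_exponent I)
    have "range (\<lambda>t. exp (\<i> * ?I t)) \<subseteq> {1, -1}" using one by (auto simp: power2_eq_1_iff)
    then show "finite (range (\<lambda>t. exp (\<i> * ?I t)))" by (rule finite_subset) simp
  qed simp
  then obtain y where y: "exp (\<i> * ?I t) = y" for t unfolding constant_on_def by blast
  have "y = 1" using y[of 0] by simp
  then have "F (cis t) = cis t powi m * exp (?R t)" for t
    using F[of "cis t"] y by (simp add: E exp_add)
  moreover have "(\<lambda>k. Re (d k)) abs_summable_on UNIV" using d by (rule abs_summable_Re)
  ultimately show thesis using that by blast
qed

section \<open>Lattice variables whose characteristic function has no zero\<close>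

lemma finite_signed_measure_diff:
  fixes M N :: "real measure"
  assumes "finite_measure M" "finite_measure N" "sets M = sets borel" "sets N = sets borel"
  shows "finite_signed_measure {B \<in> sets borel. B \<inter> {-r<..<r} = {}} (\<lambda>B. measure M B - measure N B)"
  unfolding finite_signed_measure_def
proof (intro conjI allI impI)
  fix A :: "nat \<Rightarrow> real set"
  assume A: "range A \<subseteq> {B \<in> sets borel. B \<inter> {-r<..<r} = {}} \<and> disjoint_family A"
  then have "range A \<subseteq> sets M" "range A \<subseteq> sets N" using assms by auto
  with A show "(\<lambda>i. measure M (A i) - measure N (A i)) sums (measure M (\<Union>i. A i) - measure N (\<Union>i. A i))"
    by (intro sums_diff finite_measure.finite_measure_UNION assms) auto
qed simp

text \<open>Two finite measures that live on complementary sets are the Jordan decomposition of their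
  difference. The gap around 0 puts the carrier of \<open>M\<close> itself into the domain of the supremum that
  defines the positive variation.\<close>

lemma pos_part_diff:
  fixes M N :: "real measure"
  assumes fin: "finite_measure M" "finite_measure N"
    and sets: "sets M = sets borel" "sets N = sets borel"
    and D: "D \<in> sets borel" "emeasure M (- D) = 0" "emeasure N D = 0"
    and r: "r > 0" "emeasure M {-r<..<r} = 0"
  shows "pos_part (\<lambda>B. measure M B - measure N B) = M"
proof (rule measure_eqI)
  let ?\<nu> = "\<lambda>B. measure M B - measure N B"
  show "sets (pos_part ?\<nu>) = sets M"
    unfolding pos_part_def using sets.sigma_sets_eq[of "borel :: real measure"]
    by (simp add: sets_measure_of sets)
  then have B': "B \<in> sets borel" if "B \<in> sets (pos_part ?\<nu>)" for B using that sets by simp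
  fix B assume "B \<in> sets (pos_part ?\<nu>)"
  then have B: "B \<in> sets borel" by (rule B')
  have eM: "emeasure M A = ennreal (measure M A)" for A
    using fin(1) by (simp add: finite_measure.emeasure_eq_measure)
  have "pos_variation ?\<nu> B = emeasure M B"
  proof (rule antisym)
    have "ennreal (?\<nu> A) \<le> emeasure M B" if "A \<subseteq> B" for A
    proof -
      have "ennreal (?\<nu> A) \<le> ennreal (measure M A)" by (intro ennreal_leI) simp
      also have "\<dots> \<le> emeasure M B" using that B sets unfolding eM[symmetric] by (intro emeasure_mono) auto
      finally show ?thesis .
    qed
    then show "pos_variation ?\<nu> B \<le> emeasure M B"
      unfolding pos_variation_def by (intro SUP_least) auto
    \<comment> \<open>The supremum is attained at the part of \<open>B\<close> in \<open>D\<close>, cut off near the origin.\<close>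
    let ?A = "B \<inter> D - {-r<..<r}"
    have "emeasure M (- D \<union> {-r<..<r}) = 0"
    proof -
      have "emeasure M (- D \<union> {-r<..<r}) \<le> emeasure M (- D) + emeasure M {-r<..<r}"
        using D sets by (intro emeasure_subadditive) auto
      then show ?thesis using D r by simp
    qed
    then have "AE x in M. x \<notin> - D \<union> {-r<..<r}"
      using D sets by (intro AE_not_in) (auto simp: null_sets_def)
    then have "AE x in M. x \<in> B \<longleftrightarrow> x \<in> ?A" by eventually_elim auto
    then have "emeasure M B = emeasure M ?A"
      using B D sets by (intro emeasure_eq_AE) auto
    moreover have "emeasure N ?A \<le> emeasure N D" using D sets by (intro emeasure_mono) auto
    then have "measure N ?A = 0" using D by (simp add: measure_def)
    ultimately have "emeasure M B = ennreal (?\<nu> ?A)" by (simp add: eM)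
    also have "\<dots> \<le> pos_variation ?\<nu> B"
      unfolding pos_variation_def using B D r by (intro SUP_upper) (auto simp: borel_off_zero_iff)
    finally show "emeasure M B \<le> pos_variation ?\<nu> B" .
  qed
  then show "emeasure (pos_part ?\<nu>) B = emeasure M B"
    using emeasure_pos_part[OF _ B, of ?\<nu>] finite_signed_measure_diff[OF fin sets] by simp
qed

definition lattice_measure :: "real \<Rightarrow> (int \<Rightarrow> real) \<Rightarrow> real measure" where
  "lattice_measure h w = distr (density (count_space UNIV) (\<lambda>k. ennreal (w k))) borel (\<lambda>k. h * of_int k)"

lemma sets_lattice_measure [simp]: "sets (lattice_measure h w) = sets borel"
  by (simp add: lattice_measure_def)

lemma emeasure_lattice_measure:
  assumes "B \<in> sets borel"
  shows "emeasure (lattice_measure h w) B =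
    (\<integral>\<^sup>+k. ennreal (w k) * indicator {k. h * of_int k \<in> B} k \<partial>count_space UNIV)"
  unfolding lattice_measure_def using assms
  by (subst emeasure_distr) (auto simp: emeasure_density vimage_def)

lemma finite_lattice_measure:
  assumes "\<And>k. 0 \<le> w k" "w abs_summable_on UNIV"
  shows "finite_measure (lattice_measure h w)"
proof (rule finite_measureI)
  have "(\<integral>\<^sup>+k. ennreal (w k) \<partial>count_space UNIV) < \<infinity>"
    using assms by (simp add: abs_summable_on_def integrable_iff_bounded)
  then show "emeasure (lattice_measure h w) (space (lattice_measure h w)) \<noteq> \<infinity>"
    by (simp add: lattice_measure_def emeasure_distr emeasure_density)
qed

lemma integral_lattice_measure:
  fixes g :: "real \<Rightarrow> complex"
  assumes "\<And>k. 0 \<le> w k" "g \<in> borel_measurable borel"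
  shows "(CLINT x|lattice_measure h w. g x) = (\<Sum>\<^sub>ak. complex_of_real (w k) * g (h * of_int k))"
  unfolding lattice_measure_def using assms
  by (simp add: integral_distr integral_density infsetsum_def scaleR_conv_of_real)

lemma lattice_quasi_levy:
  fixes c :: "int \<Rightarrow> real" and h :: real
  assumes c: "c abs_summable_on UNIV" "c 0 = 0" and h: "h > 0"
  obtains \<nu> where "quasi_levy_type \<nu>"
    "\<And>g. g \<in> borel_measurable borel \<Longrightarrow> bounded (range g) \<Longrightarrow>
       quasi_levy_integral \<nu> g = (\<Sum>\<^sub>ak. complex_of_real (c k) * g (h * of_int k))"
proof -
  let ?p = "\<lambda>k. max 0 (c k)" and ?n = "\<lambda>k. max 0 (- c k)"
  define M where "M = lattice_measure h ?p"
  define N where "N = lattice_measure h ?n"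
  define \<nu> where "\<nu> = (\<lambda>B. measure M B - measure N B)"
  have p: "?p abs_summable_on UNIV" and n: "?n abs_summable_on UNIV"
    by (rule abs_summable_on_comparison_test'[OF abs_summable_on_normI[OF c(1)]], simp)+
  have fin: "finite_measure M" "finite_measure N"
    using finite_lattice_measure[OF _ p, of h] finite_lattice_measure[OF _ n, of h]
    by (simp_all add: M_def N_def)
  have sets: "sets M = sets borel" "sets N = sets borel" by (simp_all add: M_def N_def)
  \<comment> \<open>\<open>D\<close> carries \<open>M\<close> and its complement carries \<open>N\<close>; neither charges \<open>(-h, h)\<close> since \<open>c 0 = 0\<close>.\<close>
  define D where "D = (\<lambda>k. h * of_int k) ` {k. 0 \<le> c k}"
  have D: "D \<in> sets borel"
    unfolding D_def by (rule sets.countable) auto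
  have inD: "h * of_int k \<in> D \<longleftrightarrow> 0 \<le> c k" for k using h by (auto simp: D_def)
  have zero: "emeasure (lattice_measure h w) B = 0" if "B \<in> sets borel" "\<And>k. h * of_int k \<in> B \<Longrightarrow> w k \<le> 0" for w B
  proof -
    have *: "(\<lambda>k. ennreal (w k) * indicator {k. h * of_int k \<in> B} k) = (\<lambda>_. 0)"
      using that(2) by (auto simp: fun_eq_iff indicator_def ennreal_neg)
    show ?thesis unfolding emeasure_lattice_measure[OF that(1)] * by simp
  qed
  have near: "k = 0" if "h * of_int k \<in> {- h<..<h}" for k :: int
  proof -
    have "h * (-1) < h * of_int k" "h * of_int k < h * 1" using that by auto
    then have "- 1 < (of_int k :: real)" "(of_int k :: real) < 1" using h by (simp_all only: mult_less_cancel_left_pos)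
    then show ?thesis by linarith
  qed
  have pos: "pos_part \<nu> = M" unfolding \<nu>_def
  proof (rule pos_part_diff[OF fin sets D])
    show "emeasure M (- D) = 0" unfolding M_def by (rule zero) (use D inD in auto)
    show "emeasure N D = 0" unfolding N_def by (rule zero) (use D inD in auto)
    show "emeasure M {- h<..<h} = 0" unfolding M_def
    proof (rule zero)
      fix k :: int assume "h * of_int k \<in> {- h<..<h}"
      then have "k = 0" by (rule near)
      then show "max 0 (c k) \<le> 0" using c(2) by simp
    qed simp
  qed (rule h)
  have "pos_part (\<lambda>B. measure N B - measure M B) = N"
  proof (rule pos_part_diff[OF fin(2,1) sets(2,1)])
    show "- D \<in> sets borel" using D by auto
    show "emeasure N (- (- D)) = 0" unfolding N_def by (rule zero) (use D inD in auto)
    show "emeasure M (- D) = 0" unfolding M_def by (rule zero) (use D inD in auto)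
    show "emeasure N {- h<..<h} = 0" unfolding N_def
    proof (rule zero)
      fix k :: int assume "h * of_int k \<in> {- h<..<h}"
      then have "k = 0" by (rule near)
      then show "max 0 (- c k) \<le> 0" using c(2) by simp
    qed simp
  qed (rule h)
  then have neg: "neg_part \<nu> = N" by (simp add: neg_part_def \<nu>_def)
  show thesis
  proof (rule that[of \<nu>])
    have "(\<integral>\<^sup>+x. ennreal (min 1 (x\<^sup>2)) \<partial>total_variation \<nu>) \<le> (\<integral>\<^sup>+x. 1 \<partial>total_variation \<nu>)"
      by (intro nn_integral_mono) simp
    also have "\<dots> = emeasure M UNIV + emeasure N UNIV"
      using emeasure_total_variation[of UNIV \<nu>] pos neg by (simp add: total_variation_def)
    also have "\<dots> < \<infinity>"
      using fin by (simp add: finite_measure.emeasure_eq_measure)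
    finally show "quasi_levy_type \<nu>"
      unfolding quasi_levy_type_def using finite_signed_measure_diff[OF fin sets] by (auto simp: \<nu>_def)
    fix g :: "real \<Rightarrow> complex"
    assume g: "g \<in> borel_measurable borel" "bounded (range g)"
    then obtain K where K: "\<And>x. norm (g x) \<le> K" by (auto simp: bounded_iff)
    have s: "(\<lambda>k. complex_of_real (w k) * g (h * of_int k)) abs_summable_on UNIV"
      if "w abs_summable_on UNIV" for w :: "int \<Rightarrow> real"
    proof (rule abs_summable_on_comparison_test')
      show "(\<lambda>k. K * norm (w k)) abs_summable_on UNIV"
        using abs_summable_on_normI[OF that] by (rule abs_summable_on_cmult_right)
      show "norm (complex_of_real (w k) * g (h * of_int k)) \<le> K * norm (w k)" for k
        using mult_left_mono[OF K[of "h * of_int k"], of "norm (w k)"] by (simp add: norm_mult mult.commute)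
    qed
    have "quasi_levy_integral \<nu> g = (\<Sum>\<^sub>ak. complex_of_real (?p k) * g (h * of_int k)) - (\<Sum>\<^sub>ak. complex_of_real (?n k) * g (h * of_int k))"
      unfolding quasi_levy_integral_def pos neg M_def N_def
      by (simp only: integral_lattice_measure[OF max.cobounded1 g(1)])
    also have "\<dots> = (\<Sum>\<^sub>ak. complex_of_real (?p k) * g (h * of_int k) - complex_of_real (?n k) * g (h * of_int k))"
      by (rule infsetsum_diff[OF s[OF p] s[OF n], symmetric])
    also have "\<dots> = (\<Sum>\<^sub>ak. complex_of_real (c k) * g (h * of_int k))"
      by (rule infsetsum_cong) (simp_all add: max_def)
    finally show "quasi_levy_integral \<nu> g = (\<Sum>\<^sub>ak. complex_of_real (c k) * g (h * of_int k))" .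
  qed
qed

lemma truncation_measurable [measurable]: "truncation \<in> borel_measurable borel"
  unfolding truncation_def[abs_def] by measurable

lemma abs_truncation_le: "\<bar>truncation x\<bar> \<le> 1"
  by (simp add: truncation_def)

text \<open>On the circle, \<open>p z = z\<^sup>m exp (\<Sum>\<^sub>k c\<^sub>k (z\<^sup>k - 1))\<close> with real \<open>c\<^sub>k\<close>. For \<open>z = exp (\<i> h
  \<theta>)\<close> this is the required form of the characteristic function, with \<open>\<nu> = \<Sum>\<^sub>k c\<^sub>k \<delta>\<^sub>h\<^sub>k\<close> and
  no Gaussian part, the sum running over \<open>k \<noteq> 0\<close>; the drift absorbs \<open>m\<close> and the truncation terms,
  which are summable because the truncation is bounded.\<close>

lemma qid_variable_lattice:
  fixes p :: "complex poly" and h :: real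
  assumes P: "prob_space P" and X: "X \<in> borel_measurable P" and h: "h > 0"
    and char: "\<And>\<theta>. char (distr P borel X) \<theta> = poly p (cis (h * \<theta>))"
    and nz: "\<And>z. norm z = 1 \<Longrightarrow> poly p z \<noteq> 0"
  shows "qid_variable P X"
proof -
  interpret prob_space P by (rule P)
  interpret D: real_distribution "distr P borel X" using X by (rule real_distribution_distr)
  have poly_cis: "poly p (cis t) = char (distr P borel X) (t / h)" for t
    using char[of "t / h"] h by simp
  have one: "poly p 1 = 1" using poly_cis[of 0] D.char_zero by simp
  have sym: "poly p (cnj z) / poly p 1 = cnj (poly p z / poly p 1)" if "norm z = 1" for z
  proof -
    have z: "z = cis (Arg z)" using rcis_cmod_Arg[of z] that by (simp add: rcis_def)
    have "poly p (cis (- t)) = cnj (poly p (cis t))" for t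
      unfolding poly_cis char_def Bochner_Integration.integral_cnj[symmetric]
      by (simp add: exp_cnj)
    then show ?thesis unfolding one by (subst z, subst (2) z) (simp add: cis_cnj)
  qed
  obtain m c where c: "c abs_summable_on UNIV"
    and mc: "\<And>t. poly p (cis t) / poly p 1 =
      cis t powi m * exp (\<Sum>\<^sub>ak. complex_of_real (c k) * (cis t powi k - 1))"
    using real_circle_exponent[OF circle_exponential_poly[OF nz] sym] by blast
  \<comment> \<open>The term at \<open>k = 0\<close> vanishes, so its coefficient may be dropped: \<open>\<nu>\<close> must not charge the origin.\<close>
  define d where "d = c(0 := 0)"
  have d: "d abs_summable_on UNIV"
    using c by (rule abs_summable_on_comparison_test) (simp add: d_def)
  obtain \<nu> where \<nu>: "quasi_levy_type \<nu>"
    "\<And>g. g \<in> borel_measurable borel \<Longrightarrow> bounded (range g) \<Longrightarrow>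
       quasi_levy_integral \<nu> g = (\<Sum>\<^sub>ak. complex_of_real (d k) * g (h * of_int k))"
    using lattice_quasi_levy[OF d _ h] by (auto simp: d_def)
  define \<gamma> where "\<gamma> = h * of_int m + (\<Sum>\<^sub>ak. d k * truncation (h * of_int k))"
  have sT: "(\<lambda>k. d k * truncation (h * of_int k)) abs_summable_on UNIV"
    using d
  proof (rule abs_summable_on_comparison_test)
    show "norm (d k * truncation (h * of_int k)) \<le> norm (d k)" for k
      using mult_left_mono[OF abs_truncation_le, of "\<bar>d k\<bar>"] by (simp add: abs_mult)
  qed
  have "char (distr P borel X) \<theta> =
      exp (\<i> * \<theta> * \<gamma> - \<theta>\<^sup>2 / 2 * 0 +
        quasi_levy_integral \<nu> (\<lambda>x. exp (\<i> * \<theta> * x) - 1 - \<i> * \<theta> * truncation x))" for \<theta> :: real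
  proof -
    let ?g = "\<lambda>x::real. exp (\<i> * \<theta> * x) - 1 - \<i> * \<theta> * truncation x"
    let ?z = "cis (h * \<theta>)"
    have "norm (?g x) \<le> 2 + \<bar>\<theta>\<bar>" for x
    proof -
      have "norm (?g x) \<le> norm (exp (\<i> * \<theta> * x) - 1) + norm (\<i> * \<theta> * truncation x)"
        by (rule norm_triangle_ineq4)
      also have "norm (exp (\<i> * \<theta> * x) - 1) \<le> norm (exp (\<i> * \<theta> * x)) + norm (1::complex)"
        by (rule norm_triangle_ineq4)
      also have "norm (exp (\<i> * \<theta> * x)) = 1" by (simp add: norm_exp_eq_Re)
      also have "norm (\<i> * \<theta> * truncation x) \<le> \<bar>\<theta>\<bar> * 1"
        using mult_left_mono[OF abs_truncation_le, of "\<bar>\<theta>\<bar>"] by (simp add: norm_mult)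
      finally show ?thesis by simp
    qed
    then have "bounded (range ?g)" by (auto simp: bounded_iff)
    then have "quasi_levy_integral \<nu> ?g = (\<Sum>\<^sub>ak. complex_of_real (d k) * ?g (h * of_int k))"
      by (intro \<nu>(2)) auto
    also have "\<dots> = (\<Sum>\<^sub>ak. complex_of_real (d k) * (?z powi k - 1) -
        \<i> * \<theta> * complex_of_real (d k * truncation (h * of_int k)))"
    proof (rule infsetsum_cong)
      fix k :: int
      have "exp (\<i> * \<theta> * complex_of_real (h * of_int k)) = ?z powi k"
        unfolding cis_power_int by (simp add: cis_conv_exp mult_ac)
      then show "complex_of_real (d k) * ?g (h * of_int k) = complex_of_real (d k) * (?z powi k - 1) -
        \<i> * \<theta> * complex_of_real (d k * truncation (h * of_int k))"
        by (simp add: algebra_simps)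
    qed simp
    also have "\<dots> = (\<Sum>\<^sub>ak. complex_of_real (d k) * (?z powi k - 1)) -
        (\<Sum>\<^sub>ak. \<i> * \<theta> * complex_of_real (d k * truncation (h * of_int k)))"
      using d sT
      by (intro infsetsum_diff abs_summable_circle_exponent abs_summable_on_cmult_right)
         (simp_all only: abs_summable_complex_of_real norm_cis)
    also have "(\<Sum>\<^sub>ak. \<i> * \<theta> * complex_of_real (d k * truncation (h * of_int k))) =
        \<i> * \<theta> * complex_of_real (\<Sum>\<^sub>ak. d k * truncation (h * of_int k))"
      using sT
      by (subst infsetsum_cmult_right) (simp_all only: abs_summable_complex_of_real infsetsum_of_real)
    also have "(\<Sum>\<^sub>ak. complex_of_real (d k) * (?z powi k - 1)) = (\<Sum>\<^sub>ak. complex_of_real (c k) * (?z powi k - 1))"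
      by (rule infsetsum_cong) (auto simp: d_def)
    finally have "\<i> * \<theta> * \<gamma> - \<theta>\<^sup>2 / 2 * 0 + quasi_levy_integral \<nu> ?g =
        \<i> * \<theta> * complex_of_real (h * of_int m) + (\<Sum>\<^sub>ak. complex_of_real (c k) * (?z powi k - 1))"
      by (simp add: \<gamma>_def algebra_simps)
    moreover have "exp (\<i> * \<theta> * complex_of_real (h * of_int m)) = ?z powi m"
      unfolding cis_power_int by (simp add: cis_conv_exp mult_ac)
    ultimately show ?thesis using mc[of "h * \<theta>"] by (simp add: char one exp_add)
  qed
  then show ?thesis unfolding qid_variable_def using P X \<nu>(1)
    by (intro conjI exI[of _ \<gamma>] exI[of _ 0] exI[of _ \<nu>]) simp_all
qed

section \<open>Vague approximation by finitely many quantized atoms\<close>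

text \<open>The points \<open>d 0, \<dots>, d n\<close> may coincide, in which case their weights add up.\<close>

definition atomic_measure :: "(nat \<Rightarrow> 'a::polish_space) \<Rightarrow> nat \<Rightarrow> (nat \<Rightarrow> real) \<Rightarrow> 'a measure" where
  "atomic_measure d n w = distr (point_measure {..n} (\<lambda>j. ennreal (w j))) borel d"

lemma sets_atomic_measure [simp]: "sets (atomic_measure d n w) = sets borel"
  by (simp add: atomic_measure_def)

lemma emeasure_atomic_measure:
  assumes "\<And>j. 0 \<le> w j" "B \<in> sets borel"
  shows "emeasure (atomic_measure d n w) B = ennreal (\<Sum>j\<in>{j\<in>{..n}. d j \<in> B}. w j)"
proof -
  have "emeasure (atomic_measure d n w) B = emeasure (point_measure {..n} (\<lambda>j. ennreal (w j))) {j\<in>{..n}. d j \<in> B}"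
    unfolding atomic_measure_def using assms(2)
    by (subst emeasure_distr) (auto simp: space_point_measure intro!: arg_cong[where f = "emeasure _"])
  also have "\<dots> = (\<Sum>j\<in>{j\<in>{..n}. d j \<in> B}. ennreal (w j))"
    by (rule emeasure_point_measure_finite) auto
  finally show ?thesis using assms(1) by (simp add: sum_ennreal)
qed

lemma measure_atomic_measure:
  assumes "\<And>j. 0 \<le> w j" "B \<in> sets borel"
  shows "measure (atomic_measure d n w) B = (\<Sum>j\<in>{j\<in>{..n}. d j \<in> B}. w j)"
  using emeasure_atomic_measure[OF assms, of d n] assms(1)
  by (simp add: measure_def sum_nonneg)

lemma integral_atomic_measure:
  fixes f :: "'a::polish_space \<Rightarrow> real"
  assumes "\<And>j. 0 \<le> w j" "f \<in> borel_measurable borel"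
  shows "(\<integral>x. f x \<partial>atomic_measure d n w) = (\<Sum>j\<le>n. w j * f (d j))"
  unfolding atomic_measure_def using assms
  by (simp add: integral_distr lebesgue_integral_point_measure_finite)

lemma atomic_measure_locally_finite:
  assumes "\<And>j. 0 \<le> w j"
  shows "atomic_measure d n w \<in> locally_finite_measures"
  using assms by (auto simp: locally_finite_measures_def bounded_borel_def emeasure_atomic_measure)

text \<open>By definition the integrals of test functions generate the topology, so neighbourhoods from
  the subbase suffice.\<close>

lemma limitin_vague_topology:
  assumes M: "\<And>n. M n \<in> locally_finite_measures" "\<mu> \<in> locally_finite_measures"
    and lim: "\<And>f. f \<in> vague_test_functions \<Longrightarrow> (\<lambda>n. \<integral>x. f x \<partial>M n) \<longlonglongrightarrow> (\<integral>x. f x \<partial>\<mu>)"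
  shows "limitin vague_topology M \<mu> sequentially"
  unfolding limitin_def topspace_vague_topology
proof (intro conjI allI impI)
  let ?S = "{{\<mu> \<in> locally_finite_measures. (\<integral>x. f x \<partial>\<mu>) \<in> U} | f U. f \<in> vague_test_functions \<and> open U}"
  fix U assume "openin vague_topology U \<and> \<mu> \<in> U"
  then have "generate_topology_on ?S U" "\<mu> \<in> U"
    by (auto simp: vague_topology_def openin_topology_generated_by_iff)
  then show "\<forall>\<^sub>F n in sequentially. M n \<in> U"
  proof (induction rule: generate_topology_on.induct)
    case (Int a b)
    then show ?case by (auto intro: eventually_conj)
  next
    case (UN K)
    then obtain k where k: "k \<in> K" "\<mu> \<in> k" by blast
    with UN have "\<forall>\<^sub>F n in sequentially. M n \<in> k" by blast
    then show ?case by eventually_elim (use k in blast)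
  next
    case (Basis s)
    then obtain f V where s: "s = {\<mu> \<in> locally_finite_measures. (\<integral>x. f x \<partial>\<mu>) \<in> V}"
      "f \<in> vague_test_functions" "open V" by blast
    with Basis lim[OF s(2)] have "\<forall>\<^sub>F n in sequentially. (\<integral>x. f x \<partial>M n) \<in> V"
      by (auto simp: tendsto_def)
    then show ?case by eventually_elim (use s M in auto)
  qed simp
qed (rule M(2))

text \<open>The points for which \<open>d j\<close> is the nearest among \<open>d 0, \<dots>, d n\<close>, ties going to the least index
  so that cells are disjoint. Cutting at distance 1 makes them bounded, also when the nearest
  point is far away.\<close>

definition nearest_cell :: "(nat \<Rightarrow> 'a::metric_space) \<Rightarrow> nat \<Rightarrow> nat \<Rightarrow> 'a set" where
  "nearest_cell d n j =
     {x. j \<le> n \<and> dist x (d j) < 1 \<and>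
         (\<forall>i\<in>{..n}. dist x (d j) \<le> dist x (d i)) \<and> (\<forall>i\<in>{..<j}. dist x (d j) < dist x (d i))}"

lemma disjoint_nearest_cell: "disjoint_family (nearest_cell d n)"
proof -
  have "nearest_cell d n i \<inter> nearest_cell d n j = {}" if "i < j" for i j
  proof -
    have False if "x \<in> nearest_cell d n i" "x \<in> nearest_cell d n j" for x
    proof -
      have "dist x (d i) \<le> dist x (d j)" "dist x (d j) < dist x (d i)"
        using that \<open>i < j\<close> by (auto simp: nearest_cell_def)
      then show False by simp
    qed
    then show ?thesis by blast
  qed
  then show ?thesis unfolding disjoint_family_on_def by (metis Int_commute linorder_neqE_nat)
qed

lemma nearest_cell_bounded_borel:
  fixes d :: "nat \<Rightarrow> 'a::polish_space"
  shows "nearest_cell d n j \<in> bounded_borel"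
proof -
  have "nearest_cell d n j \<in> sets borel"
    unfolding nearest_cell_def by measurable
  moreover have "nearest_cell d n j \<subseteq> cball (d j) 1"
    by (auto simp: nearest_cell_def dist_commute)
  then have "bounded (nearest_cell d n j)" by (rule bounded_subset[OF bounded_cball])
  ultimately show ?thesis by (simp add: bounded_borel_def)
qed

lemma nearest_cell_exists:
  assumes "i \<le> n" "dist x (d i) < \<delta>" "\<delta> \<le> 1"
  obtains j where "x \<in> nearest_cell d n j" "dist x (d j) < \<delta>"
proof -
  let ?P = "\<lambda>j. j \<le> n \<and> (\<forall>i\<le>n. dist x (d j) \<le> dist x (d i))"
  have "finite ((\<lambda>i. dist x (d i)) ` {..n})" "(\<lambda>i. dist x (d i)) ` {..n} \<noteq> {}" by auto
  from Min_in[OF this] Min_le[OF this(1)] have "\<exists>j. ?P j" by fastforce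
  then have P: "?P (LEAST j. ?P j)" by (rule LeastI_ex)
  have less: "dist x (d (LEAST j. ?P j)) < dist x (d i)" if "i < (LEAST j. ?P j)" for i
    using not_less_Least[OF that] P that by (meson le_less_trans less_imp_le_nat not_le order_trans)
  have "dist x (d (LEAST j. ?P j)) < \<delta>" using P assms by (meson le_less_trans)
  with P less assms(3) show thesis by (intro that[of "LEAST j. ?P j"]) (auto simp: nearest_cell_def)
qed

lemma sum_indicator_nearest_cell:
  fixes g :: "nat \<Rightarrow> real"
  assumes "x \<in> nearest_cell d n j"
  shows "(\<Sum>i\<le>n. indicator (nearest_cell d n i) x * g i) = g j"
proof -
  have "indicator (nearest_cell d n i) x * g i = (if i = j then g j else 0)" for i
  proof (cases "i = j")
    case False
    then have "x \<notin> nearest_cell d n i"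
      using assms disjoint_nearest_cell[of d n] unfolding disjoint_family_on_def by blast
    then show ?thesis using False by simp
  qed (use assms in simp)
  moreover have "j \<le> n" using assms by (simp add: nearest_cell_def)
  ultimately show ?thesis by simp
qed

text \<open>Cells have radius at most 1, so those that matter for \<open>f\<close> lie in the 1-neighbourhood of the
  support of \<open>f\<close>. This one bounded set dominates all stages of the approximation.\<close>

lemma vague_test_function_bounds:
  fixes f :: "'a::polish_space \<Rightarrow> real" and d :: "nat \<Rightarrow> 'a"
  assumes "f \<in> vague_test_functions"
  obtains K U where "\<And>x. \<bar>f x\<bar> \<le> K" "U \<in> bounded_borel"
    "\<And>n j. f (d j) \<noteq> 0 \<Longrightarrow> nearest_cell d n j \<subseteq> U"
proof -
  have "bounded (range f)" using assms by (simp add: vague_test_functions_def)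
  then obtain K where "\<forall>y\<in>range f. norm y \<le> K" unfolding bounded_iff by blast
  then have K: "\<bar>f x\<bar> \<le> K" for x by auto
  obtain a R where R: "{x. f x \<noteq> 0} \<subseteq> cball a R"
    using assms bounded_subset_cball by (auto simp: vague_test_functions_def) blast
  show thesis
  proof (rule that[OF K, of "cball a (R + 1)"])
    show "cball a (R + 1) \<in> bounded_borel" by (simp add: bounded_borel_def)
    fix n j assume "f (d j) \<noteq> 0"
    then have "dist a (d j) \<le> R" using R by auto
    show "nearest_cell d n j \<subseteq> cball a (R + 1)"
    proof
      fix x assume "x \<in> nearest_cell d n j"
      then have "dist (d j) x < 1" by (simp add: nearest_cell_def dist_commute)
      with \<open>dist a (d j) \<le> R\<close> show "x \<in> cball a (R + 1)"
        using dist_triangle[of a x "d j"] by simp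
    qed
  qed
qed

text \<open>The sum is the integral of a step function with value \<open>f (d j)\<close> on the \<open>j\<close>-th cell. Every
  point is eventually close to its nearest \<open>d j\<close>, so the step functions converge to \<open>f\<close> pointwise.\<close>

lemma quantization_tendsto:
  fixes f :: "'a::polish_space \<Rightarrow> real" and d :: "nat \<Rightarrow> 'a"
  assumes dense: "\<And>x \<delta>. \<delta> > 0 \<Longrightarrow> \<exists>i. dist x (d i) < \<delta>"
    and \<mu>: "\<mu> \<in> locally_finite_measures" and f: "f \<in> vague_test_functions"
  shows "(\<lambda>n. \<Sum>j\<le>n. measure \<mu> (nearest_cell d n j) * f (d j)) \<longlonglongrightarrow> (\<integral>x. f x \<partial>\<mu>)"
proof -
  obtain K U where K: "\<And>x. \<bar>f x\<bar> \<le> K" and U: "U \<in> bounded_borel"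
    and cell_U: "\<And>n j. f (d j) \<noteq> 0 \<Longrightarrow> nearest_cell d n j \<subseteq> U"
    using vague_test_function_bounds[OF f, of d] by blast
  have sets: "sets \<mu> = sets borel" using \<mu> by (simp add: locally_finite_measures_def)
  have space: "space \<mu> = UNIV" using sets_eq_imp_space_eq[OF sets] by simp
  have fin: "emeasure \<mu> B < \<infinity>" "B \<in> sets \<mu>" if "B \<in> bounded_borel" for B
    using \<mu> that sets by (auto simp: locally_finite_measures_def bounded_borel_def)
  have cont: "continuous_on UNIV f" using f by (simp add: vague_test_functions_def)
  then have fm: "f \<in> borel_measurable \<mu>"
    using borel_measurable_continuous_onI measurable_cong_sets[OF sets refl] by blast
  define F where "F n x = (\<Sum>j\<le>n. indicator (nearest_cell d n j) x * f (d j))" for n x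
  have cell: "nearest_cell d n j \<in> sets \<mu>" "emeasure \<mu> (nearest_cell d n j) < \<infinity>" for n j
    using fin nearest_cell_bounded_borel[of d n j] by auto
  have int: "(\<integral>x. F n x \<partial>\<mu>) = (\<Sum>j\<le>n. measure \<mu> (nearest_cell d n j) * f (d j))" for n
    unfolding F_def using cell
    by (subst Bochner_Integration.integral_sum) (auto intro!: integrable_real_indicator)
  have Fm: "F n \<in> borel_measurable \<mu>" for n
    unfolding F_def using cell by (intro borel_measurable_sum borel_measurable_times borel_measurable_indicator) auto
  have bound: "norm (F n x) \<le> K * indicator U x" for n x
  proof (cases "\<exists>j. x \<in> nearest_cell d n j")
    case True
    then obtain j where j: "x \<in> nearest_cell d n j" by blast
    have "x \<in> U" if "f (d j) \<noteq> 0" using cell_U[OF that, of n] j by blast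
    then show ?thesis
      using K[of "d j"] K[of x] unfolding F_def sum_indicator_nearest_cell[OF j]
      by (cases "f (d j) = 0") (auto simp: indicator_def)
  next
    case False
    then have "F n x = 0" by (simp add: F_def)
    moreover have "0 \<le> K" using K[of x] by linarith
    ultimately show ?thesis by simp
  qed
  have lim: "(\<lambda>n. F n x) \<longlonglongrightarrow> f x" for x
  proof (rule LIMSEQ_I)
    fix e :: real assume "e > 0"
    with cont obtain \<delta> where \<delta>: "\<delta> > 0" "\<And>y. dist y x < \<delta> \<Longrightarrow> dist (f y) (f x) < e"
      unfolding continuous_on_iff by (metis UNIV_I)
    obtain i where i: "dist x (d i) < min \<delta> 1" using dense[of "min \<delta> 1" x] \<delta>(1) by auto
    have "norm (F n x - f x) < e" if n: "i \<le> n" for n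
    proof -
      obtain j where j: "x \<in> nearest_cell d n j" "dist x (d j) < min \<delta> 1"
        using nearest_cell_exists[where d = d and \<delta> = "min \<delta> 1", OF n i] by auto
      have "F n x = f (d j)" unfolding F_def by (rule sum_indicator_nearest_cell[OF j(1)])
      then show ?thesis using \<delta>(2)[of "d j"] j(2) by (simp add: dist_commute dist_real_def)
    qed
    then show "\<exists>no. \<forall>n\<ge>no. norm (F n x - f x) < e" by blast
  qed
  have "(\<lambda>n. \<integral>x. F n x \<partial>\<mu>) \<longlonglongrightarrow> (\<integral>x. f x \<partial>\<mu>)"
  proof (rule integral_dominated_convergence[where w = "\<lambda>x. K * indicator U x"])
    show "integrable \<mu> (\<lambda>x. K * indicator U x)"
      using fin[OF U] by (intro integrable_mult_right integrable_real_indicator) auto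
  qed (use fm Fm lim bound in auto)
  then show ?thesis unfolding int .
qed

text \<open>Rounding down makes the masses multiples of \<open>2\<^sup>-\<^sup>n\<close>, and the cap at total value \<open>n\<close> makes
  their range finite. Outside \<open>{..n}\<close> the value is 0, the default value of the product laws below.\<close>

definition quantized_mass :: "(nat \<Rightarrow> 'a::polish_space) \<Rightarrow> nat \<Rightarrow> 'a measure \<Rightarrow> nat \<Rightarrow> nat" where
  "quantized_mass d n \<mu> j =
     (if j \<le> n then min (n * 2 ^ n) (nat \<lfloor>2 ^ n * measure \<mu> (nearest_cell d n j)\<rfloor>) else 0)"

text \<open>For a fixed test function the cap is inactive once \<open>n\<close> exceeds the mass of the relevant
  bounded set. After that, rounding \<open>n + 1\<close> atoms changes the integral by at most a constant times
  \<open>(n + 1) / 2\<^sup>n\<close>.\<close>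

lemma quantized_mass_limitin:
  fixes d :: "nat \<Rightarrow> 'a::polish_space"
  assumes dense: "\<And>x \<delta>. \<delta> > 0 \<Longrightarrow> \<exists>i. dist x (d i) < \<delta>"
    and \<mu>: "\<mu> \<in> locally_finite_measures"
  shows "limitin vague_topology (\<lambda>n. atomic_measure d n (\<lambda>j. quantized_mass d n \<mu> j / 2 ^ n)) \<mu> sequentially"
proof (rule limitin_vague_topology)
  fix f :: "'a \<Rightarrow> real" assume f: "f \<in> vague_test_functions"
  then obtain K U where K: "\<And>x. \<bar>f x\<bar> \<le> K" and U: "U \<in> bounded_borel"
    and cell_U: "\<And>n j. f (d j) \<noteq> 0 \<Longrightarrow> nearest_cell d n j \<subseteq> U"
    using vague_test_function_bounds[OF f, of d] by blast
  have sets: "sets \<mu> = sets borel" using \<mu> by (simp add: locally_finite_measures_def)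
  have fin: "emeasure \<mu> B \<noteq> \<infinity>" "B \<in> sets \<mu>" if "B \<in> bounded_borel" for B
    using \<mu> that sets by (auto simp: locally_finite_measures_def bounded_borel_def)
  have fm: "f \<in> borel_measurable borel"
    using f by (auto simp: vague_test_functions_def intro: borel_measurable_continuous_onI)
  let ?m = "\<lambda>n j. measure \<mu> (nearest_cell d n j)"
  let ?q = "\<lambda>n j. real (quantized_mass d n \<mu> j) / 2 ^ n"
  obtain n0 where n0: "measure \<mu> U \<le> real n0" using real_arch_simple by blast
  have err: "\<bar>?q n j * f (d j) - ?m n j * f (d j)\<bar> \<le> K / 2 ^ n" if n: "n0 \<le> n" and j: "j \<le> n" for n j
  proof (cases "f (d j) = 0")
    case False
    have "?m n j \<le> measure \<mu> U"
      using cell_U[OF False, of n] fin[OF U] nearest_cell_bounded_borel[of d n j] sets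
      by (intro measure_mono_fmeasurable) (auto simp: fmeasurable_def bounded_borel_def top.not_eq_extremum)
    then have "?m n j \<le> real n" using n0 n by linarith
    then have "2 ^ n * ?m n j \<le> 2 ^ n * real n" by (intro mult_left_mono) auto
    also have "2 ^ n * real n = real (n * 2 ^ n)" by simp
    finally have "\<lfloor>2 ^ n * ?m n j\<rfloor> \<le> int (n * 2 ^ n)"
      using floor_mono floor_of_nat by metis
    then have "nat \<lfloor>2 ^ n * ?m n j\<rfloor> \<le> n * 2 ^ n" by (simp only: nat_le_iff)
    then have "quantized_mass d n \<mu> j = nat \<lfloor>2 ^ n * ?m n j\<rfloor>" using j by (simp add: quantized_mass_def)
    then have "real (quantized_mass d n \<mu> j) = of_int \<lfloor>2 ^ n * ?m n j\<rfloor>" by simp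
    then have "\<bar>real (quantized_mass d n \<mu> j) - 2 ^ n * ?m n j\<bar> \<le> 1"
      using of_int_floor_le[of "2 ^ n * ?m n j"] floor_correct[of "2 ^ n * ?m n j"] by linarith
    then have "\<bar>?q n j - ?m n j\<bar> \<le> 1 / 2 ^ n" by (simp add: field_simps abs_le_iff)
    then have "\<bar>?q n j - ?m n j\<bar> * \<bar>f (d j)\<bar> \<le> 1 / 2 ^ n * K" using K by (intro mult_mono) auto
    then show ?thesis by (simp add: abs_mult[symmetric] left_diff_distrib)
  next
    case True
    have "0 \<le> K" using K[of "d j"] by linarith
    with True show ?thesis by simp
  qed
  have lim0: "(\<lambda>n. (\<Sum>j\<le>n. ?q n j * f (d j)) - (\<Sum>j\<le>n. ?m n j * f (d j))) \<longlonglongrightarrow> 0"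
  proof (rule Lim_null_comparison)
    have "norm ((\<Sum>j\<le>n. ?q n j * f (d j)) - (\<Sum>j\<le>n. ?m n j * f (d j))) \<le> (real n / 2 ^ n + (1 / 2) ^ n) * K"
      if n: "n0 \<le> n" for n
    proof -
      have "norm ((\<Sum>j\<le>n. ?q n j * f (d j)) - (\<Sum>j\<le>n. ?m n j * f (d j))) \<le>
          (\<Sum>j\<le>n. \<bar>?q n j * f (d j) - ?m n j * f (d j)\<bar>)"
        unfolding sum_subtractf[symmetric] real_norm_def by (rule sum_abs)
      also have "\<dots> \<le> (\<Sum>j\<le>n. K / 2 ^ n)" using err[OF n] by (intro sum_mono) auto
      also have "\<dots> = (real n / 2 ^ n + (1 / 2) ^ n) * K" by (simp add: field_simps power_divide)
      finally show ?thesis .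
    qed
    then show "\<forall>\<^sub>F n in sequentially. norm ((\<Sum>j\<le>n. ?q n j * f (d j)) - (\<Sum>j\<le>n. ?m n j * f (d j))) \<le> (real n / 2 ^ n + (1 / 2) ^ n) * K"
      by (auto simp: eventually_sequentially)
    have "(\<lambda>n. (real n / 2 ^ n + (1 / 2) ^ n) * K) \<longlonglongrightarrow> (0 + 0) * K"
      using lim_n_over_pown[of "2::real"] by (intro tendsto_intros LIMSEQ_power_zero) auto
    then show "(\<lambda>n. (real n / 2 ^ n + (1 / 2) ^ n) * K) \<longlonglongrightarrow> 0" by simp
  qed
  have "(\<lambda>n. \<Sum>j\<le>n. ?q n j * f (d j)) \<longlonglongrightarrow> (\<integral>x. f x \<partial>\<mu>)"
    using tendsto_add[OF lim0 quantization_tendsto[OF dense \<mu> f]] by simp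
  then show "(\<lambda>n. \<integral>x. f x \<partial>atomic_measure d n (?q n)) \<longlonglongrightarrow> (\<integral>x. f x \<partial>\<mu>)"
    using fm by (simp add: integral_atomic_measure)
qed (simp_all add: \<mu> atomic_measure_locally_finite)

section \<open>Removing the zeros by an exponential tilt\<close>

lemma ex_pmf_finite_weights:
  assumes "finite A" "\<And>k. k \<in> A \<Longrightarrow> 0 \<le> w k" "(\<Sum>k\<in>A. w k) = 1"
  shows "\<exists>q. \<forall>k. pmf q k = (if k \<in> A then w k else 0)"
proof (intro exI allI)
  fix k
  show "pmf (embed_pmf (\<lambda>k. if k \<in> A then w k else 0)) k = (if k \<in> A then w k else 0)"
  proof (rule pmf_embed_pmf)
    have "(\<integral>\<^sup>+k. ennreal (if k \<in> A then w k else 0) \<partial>count_space UNIV) =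
        (\<Sum>k\<in>A. ennreal (if k \<in> A then w k else 0))"
      by (rule nn_integral_count_space'[OF assms(1)]) simp_all
    also have "\<dots> = (\<Sum>k\<in>A. ennreal (w k))" by (rule sum.cong) simp_all
    also have "\<dots> = ennreal (\<Sum>k\<in>A. w k)" by (rule sum_ennreal) (rule assms(2))
    finally show "(\<integral>\<^sup>+k. ennreal (if k \<in> A then w k else 0) \<partial>count_space UNIV) = 1"
      using assms(3) by simp
  qed (use assms(2) in auto)
qed

text \<open>The tilted weights \<open>p\<^sub>k r\<^sup>k / Z r\<close> have the generating polynomial \<open>A (r z) / Z r\<close>, where \<open>A\<close>
  generates the \<open>p\<^sub>k\<close>. It vanishes on the unit circle only if \<open>r\<close> is the modulus of a root of \<open>A\<close>,
  which excludes finitely many \<open>r\<close>. The products of the tilted weights are continuous in \<open>r\<close> and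
  return to the original ones at \<open>r = 1\<close>.\<close>

lemma exponential_tilt_approximation:
  fixes p :: "'i \<Rightarrow> nat \<Rightarrow> real" and N :: nat
  assumes I: "finite I"
    and p: "\<And>j k. 0 \<le> p j k" "\<And>j. j \<in> I \<Longrightarrow> (\<Sum>k\<le>N. p j k) = 1"
    and \<epsilon>: "\<epsilon> > 0"
  obtains q :: "'i \<Rightarrow> nat pmf" where
    "\<And>j. j \<in> I \<Longrightarrow> set_pmf (q j) \<subseteq> {..N}"
    "\<And>j z. j \<in> I \<Longrightarrow> norm z = 1 \<Longrightarrow> (\<Sum>k\<le>N. complex_of_real (pmf (q j) k) * z ^ k) \<noteq> 0"
    "(\<Sum>\<kappa>\<in>PiE_dflt I 0 (\<lambda>_. {..N}). \<bar>(\<Prod>j\<in>I. p j (\<kappa> j)) - (\<Prod>j\<in>I. pmf (q j) (\<kappa> j))\<bar>) < \<epsilon>"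
proof -
  let ?X = "PiE_dflt I 0 (\<lambda>_. {..N})"
  define Z where "Z j r = (\<Sum>k\<le>N. p j k * r ^ k)" for j r
  define t where "t r j k = p j k * r ^ k / Z j r" for r j k
  define A where "A j = (\<Sum>k\<le>N. monom (complex_of_real (p j k)) k)" for j
  have A: "poly (A j) z = (\<Sum>k\<le>N. complex_of_real (p j k) * z ^ k)" for j z
    by (simp add: A_def poly_sum poly_monom)
  have Z1: "Z j 1 = 1" if "j \<in> I" for j using p(2)[OF that] by (simp add: Z_def)
  have Zpos: "Z j r > 0" if "j \<in> I" "0 < r" for j r
  proof -
    have "(\<Sum>k\<le>N. p j k) \<noteq> 0" using p(2)[OF that(1)] by simp
    then obtain k where "k \<le> N" "p j k \<noteq> 0"
      using sum.not_neutral_contains_not_neutral[of "p j" "{..N}"] by auto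
    then have "0 < p j k * r ^ k" using p(1)[of j k] that(2) by simp
    with \<open>k \<le> N\<close> show ?thesis unfolding Z_def
    proof (intro sum_pos2[of "{..N}" k])
      show "0 \<le> p j i * r ^ i" for i using p(1) that(2) by simp
    qed auto
  qed
  have "isCont (\<lambda>r. \<Sum>\<kappa>\<in>?X. \<bar>(\<Prod>j\<in>I. p j (\<kappa> j)) - (\<Prod>j\<in>I. t r j (\<kappa> j))\<bar>) 1"
    unfolding t_def Z_def using p(2) by (intro continuous_intros) auto
  then have "((\<lambda>r. \<Sum>\<kappa>\<in>?X. \<bar>(\<Prod>j\<in>I. p j (\<kappa> j)) - (\<Prod>j\<in>I. t r j (\<kappa> j))\<bar>) \<longlongrightarrow>
      (\<Sum>\<kappa>\<in>?X. \<bar>(\<Prod>j\<in>I. p j (\<kappa> j)) - (\<Prod>j\<in>I. t 1 j (\<kappa> j))\<bar>)) (at_left 1)"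
    unfolding isCont_def by (rule filterlim_mono) (auto simp: at_le)
  moreover have "(\<Prod>j\<in>I. t 1 j (\<kappa> j)) = (\<Prod>j\<in>I. p j (\<kappa> j))" for \<kappa>
    by (rule prod.cong) (auto simp: t_def Z1)
  ultimately have "((\<lambda>r. \<Sum>\<kappa>\<in>?X. \<bar>(\<Prod>j\<in>I. p j (\<kappa> j)) - (\<Prod>j\<in>I. t r j (\<kappa> j))\<bar>) \<longlongrightarrow> 0) (at_left 1)"
    by simp
  then have close: "\<forall>\<^sub>F r in at_left 1. (\<Sum>\<kappa>\<in>?X. \<bar>(\<Prod>j\<in>I. p j (\<kappa> j)) - (\<Prod>j\<in>I. t r j (\<kappa> j))\<bar>) < \<epsilon>"
    using \<epsilon> by (rule order_tendstoD)
  have "A j \<noteq> 0" if "j \<in> I" for j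
  proof
    assume "A j = 0"
    then have "complex_of_real (\<Sum>k\<le>N. p j k) = 0" using A[of j 1] by simp
    then show False using p(2)[OF that] by simp
  qed
  then have "finite (\<Union>j\<in>I. norm ` {z. poly (A j) z = 0})" (is "finite ?bad")
    using I poly_roots_finite by blast
  then have "\<forall>\<^sub>F r in at_left 1. \<forall>b\<in>?bad. r \<noteq> b"
    by (intro eventually_ball_finite ballI eventually_neq_at_within)
  moreover have "\<forall>\<^sub>F r in at_left (1::real). r \<in> {0<..<1}"
    by (rule eventually_at_left_real) simp
  ultimately have "\<forall>\<^sub>F r in at_left 1. (\<forall>b\<in>?bad. r \<noteq> b) \<and> r \<in> {0<..<1} \<and>
      (\<Sum>\<kappa>\<in>?X. \<bar>(\<Prod>j\<in>I. p j (\<kappa> j)) - (\<Prod>j\<in>I. t r j (\<kappa> j))\<bar>) < \<epsilon>"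
    by (intro eventually_conj close)
  from eventually_happens'[OF trivial_limit_at_left_real this]
  obtain r where bad: "\<forall>b\<in>?bad. r \<noteq> b" and r01: "r \<in> {0<..<1}"
    and r3: "(\<Sum>\<kappa>\<in>?X. \<bar>(\<Prod>j\<in>I. p j (\<kappa> j)) - (\<Prod>j\<in>I. t r j (\<kappa> j))\<bar>) < \<epsilon>"
    by (elim exE conjE)
  have r: "0 < r" using r01 by simp
  have "\<exists>q. \<forall>k. pmf q k = (if k \<in> {..N} then t r j k else 0)" if "j \<in> I" for j
  proof (rule ex_pmf_finite_weights)
    show "0 \<le> t r j k" for k using p(1) r Zpos[OF that r] by (simp add: t_def)
    show "(\<Sum>k\<le>N. t r j k) = 1"
      unfolding t_def sum_divide_distrib[symmetric] Z_def[symmetric] using Zpos[OF that r] by simp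
  qed simp
  then have "\<exists>q. \<forall>j\<in>I. \<forall>k. pmf (q j) k = (if k \<in> {..N} then t r j k else 0)"
    by (intro bchoice) blast
  then obtain q where q: "\<And>j k. j \<in> I \<Longrightarrow> pmf (q j) k = (if k \<in> {..N} then t r j k else 0)"
    by blast
  show thesis
  proof (rule that[of q])
    show "set_pmf (q j) \<subseteq> {..N}" if "j \<in> I" for j
      using q[OF that] by (auto simp: set_pmf_eq)
    fix j and z :: complex assume j: "j \<in> I" and z: "norm z = 1"
    have nr: "norm (of_real r * z) = r" using z r by (simp add: norm_mult)
    have "poly (A j) (of_real r * z) \<noteq> 0"
    proof
      assume "poly (A j) (of_real r * z) = 0"
      then have "norm (of_real r * z) \<in> ?bad" using j by (intro UN_I imageI) simp_all
      then have "r \<noteq> norm (of_real r * z)" by (rule bspec[OF bad])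
      then show False using nr by simp
    qed
    moreover have "(\<Sum>k\<le>N. complex_of_real (pmf (q j) k) * z ^ k) = poly (A j) (of_real r * z) / of_real (Z j r)"
      unfolding A sum_divide_distrib using q[OF j] by (intro sum.cong) (auto simp: t_def power_mult_distrib)
    ultimately show "(\<Sum>k\<le>N. complex_of_real (pmf (q j) k) * z ^ k) \<noteq> 0"
      using Zpos[OF j r] by simp
  next
    have "(\<Prod>j\<in>I. pmf (q j) (\<kappa> j)) = (\<Prod>j\<in>I. t r j (\<kappa> j))" if "\<kappa> \<in> ?X" for \<kappa>
      using that by (intro prod.cong) (auto simp: q PiE_dflt_def)
    then show "(\<Sum>\<kappa>\<in>?X. \<bar>(\<Prod>j\<in>I. p j (\<kappa> j)) - (\<Prod>j\<in>I. pmf (q j) (\<kappa> j))\<bar>) < \<epsilon>"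
      using r3 by simp
  qed
qed

section \<open>Random measures with finitely many independent lattice atoms\<close>

lemma indep_vars_distr_comp:
  assumes P: "prob_space P" and f: "f \<in> P \<rightarrow>\<^sub>M N" and I: "I \<noteq> {}"
    and X: "\<And>i. i \<in> I \<Longrightarrow> X i \<in> N \<rightarrow>\<^sub>M M' i"
    and ind: "prob_space.indep_vars P M' (\<lambda>i \<omega>. X i (f \<omega>)) I"
  shows "prob_space.indep_vars (distr P N f) M' X I"
proof -
  interpret P: prob_space P by (rule P)
  interpret D: prob_space "distr P N f" by (rule P.prob_space_distr[OF f])
  have "distr (distr P N f) (PiM I M') (\<lambda>x. \<lambda>i\<in>I. X i x) = distr P (PiM I M') (\<lambda>x. \<lambda>i\<in>I. X i (f x))"
    using f X by (subst distr_distr) (auto simp: comp_def intro!: measurable_restrict)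
  also have "\<dots> = PiM I (\<lambda>i. distr P (M' i) (\<lambda>x. X i (f x)))"
    using ind P.indep_vars_iff_distr_eq_PiM'[OF I, of "\<lambda>i x. X i (f x)" M'] measurable_compose[OF f X] by simp
  also have "\<dots> = PiM I (\<lambda>i. distr (distr P N f) (M' i) (X i))"
    using f X by (intro PiM_cong) (auto simp: distr_distr comp_def)
  finally show ?thesis
    using D.indep_vars_iff_distr_eq_PiM'[OF I, of X M'] X by simp
qed

lemma indep_vars_grouped_sums:
  fixes h :: real and L :: "'l \<Rightarrow> nat set"
  assumes "finite A" "\<And>i. L i \<subseteq> A" "disjoint_family L"
  shows "prob_space.indep_vars (measure_pmf (Pi_pmf A 0 q)) (\<lambda>_. borel)
    (\<lambda>i \<kappa>. \<Sum>j\<in>L i. h * real (\<kappa> j)) UNIV"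
proof -
  let ?indep = "prob_space.indep_vars (measure_pmf (Pi_pmf A 0 q))"
  have "?indep (\<lambda>_. count_space UNIV) (\<lambda>x \<kappa>. \<kappa> x) A"
    using indep_vars_Pi_pmf[OF assms(1), of 0 q] by simp
  then have "?indep (\<lambda>_. borel) (\<lambda>x \<kappa>. h * real (\<kappa> x)) A"
    by (rule prob_space.indep_vars_compose2[OF measure_pmf.prob_space_axioms]) simp
  then have "?indep (\<lambda>i. PiM (L i) (\<lambda>_. borel)) (\<lambda>i \<kappa>. restrict (\<lambda>x. h * real (\<kappa> x)) (L i)) UNIV"
    using assms by (intro prob_space.indep_vars_restrict[OF measure_pmf.prob_space_axioms]) auto
  then have "?indep (\<lambda>_. borel) (\<lambda>i \<kappa>. (\<lambda>u. \<Sum>j\<in>L i. u j) (restrict (\<lambda>x. h * real (\<kappa> x)) (L i))) UNIV"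
    by (rule prob_space.indep_vars_compose2[OF measure_pmf.prob_space_axioms]) (auto intro!: borel_measurable_sum measurable_component_singleton)
  then show ?thesis by simp
qed

lemma char_grouped_sum:
  assumes A: "finite A" "J \<subseteq> A" and q: "\<And>j. j \<in> A \<Longrightarrow> set_pmf (q j) \<subseteq> {..N}"
  shows "char (distr (measure_pmf (Pi_pmf A 0 q)) borel (\<lambda>\<kappa>. \<Sum>j\<in>J. h * real (\<kappa> j))) \<theta> =
    (\<Prod>j\<in>J. \<Sum>k\<le>N. complex_of_real (pmf (q j) k) * cis (h * \<theta>) ^ k)"
proof -
  let ?indep = "prob_space.indep_vars (measure_pmf (Pi_pmf A 0 q))"
  have "?indep (\<lambda>_. count_space UNIV) (\<lambda>x \<kappa>. \<kappa> x) A"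
    using indep_vars_Pi_pmf[OF A(1), of 0 q] by simp
  then have "?indep (\<lambda>_. borel) (\<lambda>x \<kappa>. h * real (\<kappa> x)) A"
    by (rule prob_space.indep_vars_compose2[OF measure_pmf.prob_space_axioms]) simp
  then have "?indep (\<lambda>_. borel) (\<lambda>x \<kappa>. h * real (\<kappa> x)) J"
    by (rule prob_space.indep_vars_subset[OF measure_pmf.prob_space_axioms]) fact
  then have "char (distr (measure_pmf (Pi_pmf A 0 q)) borel (\<lambda>\<kappa>. \<Sum>j\<in>J. h * real (\<kappa> j))) \<theta> =
      (\<Prod>j\<in>J. char (distr (measure_pmf (Pi_pmf A 0 q)) borel (\<lambda>\<kappa>. h * real (\<kappa> j))) \<theta>)"
    by (rule prob_space.char_distr_sum[OF measure_pmf.prob_space_axioms])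
  also have "\<dots> = (\<Prod>j\<in>J. \<Sum>k\<le>N. complex_of_real (pmf (q j) k) * cis (h * \<theta>) ^ k)"
  proof (rule prod.cong)
    fix j assume "j \<in> J"
    then have j: "j \<in> A" using A by auto
    have "char (distr (measure_pmf (Pi_pmf A 0 q)) borel (\<lambda>\<kappa>. h * real (\<kappa> j))) \<theta> =
        (CLINT \<kappa>|measure_pmf (Pi_pmf A 0 q). iexp (\<theta> * (h * real (\<kappa> j))))"
      unfolding char_def by (subst integral_distr) auto
    also have "\<dots> = (CLINT k|map_pmf (\<lambda>\<kappa>. \<kappa> j) (Pi_pmf A 0 q). iexp (\<theta> * (h * real k)))"
      by (simp add: integral_map_pmf)
    also have "\<dots> = (CLINT k|q j. iexp (\<theta> * (h * real k)))"
      using Pi_pmf_component[OF A(1), of j 0 q] j by simp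
    also have "\<dots> = (\<Sum>k\<le>N. pmf (q j) k *\<^sub>R iexp (\<theta> * (h * real k)))"
      by (rule integral_measure_pmf) (use q[OF j] in auto)
    also have "\<dots> = (\<Sum>k\<le>N. complex_of_real (pmf (q j) k) * cis (h * \<theta>) ^ k)"
      unfolding Complex.DeMoivre by (simp add: scaleR_conv_of_real cis_conv_exp mult_ac)
    finally show "char (distr (measure_pmf (Pi_pmf A 0 q)) borel (\<lambda>\<kappa>. h * real (\<kappa> j))) \<theta> =
      (\<Sum>k\<le>N. complex_of_real (pmf (q j) k) * cis (h * \<theta>) ^ k)" .
  qed simp
  finally show ?thesis .
qed

lemma vague_continuous_measurable:
  fixes g :: "'a::polish_space measure \<Rightarrow> real"
  assumes "continuous_map vague_topology euclideanreal g"
  shows "g \<in> borel_measurable vague_borel"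
proof (rule borel_measurableI)
  fix S :: "real set" assume "open S"
  then have "openin vague_topology {\<mu> \<in> topspace vague_topology. g \<mu> \<in> S}"
    using assms by (simp add: continuous_map_def)
  moreover have "{U. openin vague_topology U} \<subseteq> Pow (topspace (vague_topology :: 'a measure topology))"
    using openin_subset by blast
  ultimately show "g -` S \<inter> space vague_borel \<in> sets vague_borel"
    by (auto simp: vague_borel_def vimage_def Int_def conj_commute intro!: sigma_sets.Basic)
qed

lemma space_vague_borel: "space (vague_borel :: 'a::polish_space measure measure) = locally_finite_measures"
proof -
  have "{U. openin vague_topology U} \<subseteq> Pow (topspace (vague_topology :: 'a measure topology))"
    using openin_subset by blast
  then show ?thesis unfolding vague_borel_def topspace_vague_topology[symmetric]
    by (rule space_measure_of)
qed

text \<open>The sample space of a discrete law on measures is the whole type, but a random measure must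
  take locally finite values everywhere; the value at the other points, all null, is arbitrary.\<close>

definition to_locally_finite :: "'a::polish_space measure \<Rightarrow> 'a measure" where
  "to_locally_finite \<mu> = (if \<mu> \<in> locally_finite_measures then \<mu> else null_measure borel)"

lemma to_locally_finite_in: "to_locally_finite \<mu> \<in> locally_finite_measures"
  by (auto simp: to_locally_finite_def locally_finite_measures_def)

definition atomic_law :: "(nat \<Rightarrow> 'a::polish_space) \<Rightarrow> nat \<Rightarrow> real \<Rightarrow> (nat \<Rightarrow> nat pmf) \<Rightarrow> 'a measure pmf" where
  "atomic_law d n h q = map_pmf (\<lambda>\<kappa>. atomic_measure d n (\<lambda>j. h * real (\<kappa> j))) (Pi_pmf {..n} 0 q)"

text \<open>The mass of \<open>B\<close> is the sum of the atoms located in \<open>B\<close>. Disjoint sets collect disjoint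
  groups of independent atoms, and the generating polynomial of a sum is the product of those of
  the summands, which again has no root on the circle.\<close>

lemma qid_random_measure_atomic_law:
  fixes d :: "nat \<Rightarrow> 'a::polish_space"
  assumes h: "h > 0"
    and q: "\<And>j. j \<in> {..n} \<Longrightarrow> set_pmf (q j) \<subseteq> {..N}"
    and nz: "\<And>j z. j \<in> {..n} \<Longrightarrow> norm z = 1 \<Longrightarrow> (\<Sum>k\<le>N. complex_of_real (pmf (q j) k) * z ^ k) \<noteq> 0"
  shows "qid_random_measure (measure_pmf (atomic_law d n h q)) to_locally_finite"
proof -
  let ?M = "\<lambda>\<kappa>. atomic_measure d n (\<lambda>j. h * real (\<kappa> j))"
  let ?\<Pi> = "measure_pmf (Pi_pmf {..n} 0 q)"
  have Q: "measure_pmf (atomic_law d n h q) = distr ?\<Pi> (count_space UNIV) ?M"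
    unfolding atomic_law_def by (rule map_pmf_rep_eq)
  have val: "measure (to_locally_finite (?M \<kappa>)) B = (\<Sum>j\<in>{j\<in>{..n}. d j \<in> B}. h * real (\<kappa> j))"
    if "B \<in> bounded_borel" for \<kappa> B
    using h that atomic_measure_locally_finite[of "\<lambda>j. h * real (\<kappa> j)" d n]
    by (simp add: to_locally_finite_def measure_atomic_measure bounded_borel_def)
  have rm: "random_measure (measure_pmf (atomic_law d n h q)) to_locally_finite"
    unfolding random_measure_def
    by (simp add: measure_pmf.prob_space_axioms space_vague_borel to_locally_finite_in)
  have "independently_scattered (measure_pmf (atomic_law d n h q)) to_locally_finite"
    unfolding independently_scattered_def
  proof (intro conjI rm allI impI)
    fix B :: "nat \<Rightarrow> 'a set"
    assume B: "disjoint_family B \<and> range B \<subseteq> bounded_borel"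
    have "prob_space.indep_vars ?\<Pi> (\<lambda>_. borel)
        (\<lambda>i \<kappa>. \<Sum>j\<in>{j\<in>{..n}. d j \<in> B i}. h * real (\<kappa> j)) UNIV"
      using B by (intro indep_vars_grouped_sums) (auto simp: disjoint_family_on_def)
    moreover have "B i \<in> bounded_borel" for i using B by blast
    ultimately have "prob_space.indep_vars ?\<Pi> (\<lambda>_. borel) (\<lambda>i \<kappa>. measure (to_locally_finite (?M \<kappa>)) (B i)) UNIV"
      by (simp add: val)
    then show "prob_space.indep_vars (measure_pmf (atomic_law d n h q)) (\<lambda>_. borel :: real measure)
        (\<lambda>i \<mu>. measure (to_locally_finite \<mu>) (B i)) UNIV"
      unfolding Q by (intro indep_vars_distr_comp measure_pmf.prob_space_axioms) auto
  qed
  moreover have "qid_variable (measure_pmf (atomic_law d n h q)) (\<lambda>\<mu>. measure (to_locally_finite \<mu>) B)"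
    if B: "B \<in> bounded_borel" for B
  proof -
    define J where "J = {j\<in>{..n}. d j \<in> B}"
    have J: "J \<subseteq> {..n}" by (auto simp: J_def)
    define p where "p = (\<Prod>j\<in>J. \<Sum>k\<le>N. monom (complex_of_real (pmf (q j) k)) k)"
    have p: "poly p z = (\<Prod>j\<in>J. \<Sum>k\<le>N. complex_of_real (pmf (q j) k) * z ^ k)" for z
      by (simp add: p_def poly_prod poly_sum poly_monom)
    show ?thesis
    proof (rule qid_variable_lattice[OF measure_pmf.prob_space_axioms _ h, of _ _ p])
      fix \<theta> :: real
      have "distr (measure_pmf (atomic_law d n h q)) borel (\<lambda>\<mu>. measure (to_locally_finite \<mu>) B) =
          distr ?\<Pi> borel (\<lambda>\<kappa>. \<Sum>j\<in>J. h * real (\<kappa> j))"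
        unfolding Q by (subst distr_distr) (simp_all add: comp_def val[OF B] J_def)
      then show "char (distr (measure_pmf (atomic_law d n h q)) borel (\<lambda>\<mu>. measure (to_locally_finite \<mu>) B)) \<theta> =
          poly p (cis (h * \<theta>))"
        using char_grouped_sum[OF finite_atMost J q, where h = h and \<theta> = \<theta>] by (simp add: p)
    next
      fix z :: complex assume "norm z = 1"
      with nz J have "(\<Sum>k\<le>N. complex_of_real (pmf (q j) k) * z ^ k) \<noteq> 0" if "j \<in> J" for j using that by blast
      moreover have "finite J" using J finite_subset by blast
      ultimately show "poly p z \<noteq> 0" unfolding p by (simp add: prod_zero_iff)
    qed simp
  qed
  ultimately show ?thesis by (simp add: qid_random_measure_def)
qed

lemma integral_atomic_law:
  fixes g :: "'a::polish_space measure \<Rightarrow> real"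
  assumes "h > 0" and q: "\<And>j. j \<in> {..n} \<Longrightarrow> set_pmf (q j) \<subseteq> {..N}"
  shows "(\<integral>\<mu>. g (to_locally_finite \<mu>) \<partial>measure_pmf (atomic_law d n h q)) =
    (\<Sum>\<kappa>\<in>PiE_dflt {..n} 0 (\<lambda>_. {..N}). g (atomic_measure d n (\<lambda>j. h * real (\<kappa> j))) * (\<Prod>j\<in>{..n}. pmf (q j) (\<kappa> j)))"
proof -
  have "to_locally_finite (atomic_measure d n (\<lambda>j. h * real (\<kappa> j))) = atomic_measure d n (\<lambda>j. h * real (\<kappa> j))" for \<kappa>
    using assms(1) atomic_measure_locally_finite[of "\<lambda>j. h * real (\<kappa> j)" d n] by (simp add: to_locally_finite_def)
  then have "(\<integral>\<mu>. g (to_locally_finite \<mu>) \<partial>measure_pmf (atomic_law d n h q)) =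
      (\<integral>\<kappa>. g (atomic_measure d n (\<lambda>j. h * real (\<kappa> j))) \<partial>measure_pmf (Pi_pmf {..n} 0 q))"
    by (simp add: atomic_law_def integral_map_pmf)
  also have "\<dots> = (\<Sum>\<kappa>\<in>PiE_dflt {..n} 0 (\<lambda>_. {..N}). g (atomic_measure d n (\<lambda>j. h * real (\<kappa> j))) * pmf (Pi_pmf {..n} 0 q) \<kappa>)"
  proof (rule integral_measure_pmf_real)
    show "\<kappa> \<in> PiE_dflt {..n} 0 (\<lambda>_. {..N})" if "\<kappa> \<in> set_pmf (Pi_pmf {..n} 0 q)" for \<kappa>
    proof -
      have "\<kappa> \<in> PiE_dflt {..n} 0 (set_pmf \<circ> q)" using that by (simp only: set_Pi_pmf[OF finite_atMost])
      then show ?thesis using q unfolding PiE_dflt_def comp_def by blast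
    qed
  qed (auto intro: finite_PiE_dflt)
  also have "\<dots> = (\<Sum>\<kappa>\<in>PiE_dflt {..n} 0 (\<lambda>_. {..N}). g (atomic_measure d n (\<lambda>j. h * real (\<kappa> j))) * (\<Prod>j\<in>{..n}. pmf (q j) (\<kappa> j)))"
    by (intro sum.cong arg_cong2[where f = "(*)"] refl pmf_Pi') (auto simp: PiE_dflt_def)
  finally show ?thesis .
qed

section \<open>Density of the QID random measures\<close>

text \<open>The joint vector takes finitely many values, each with a probability that factorizes. The
  value 0 outside \<open>I\<close> matches the default of the product law in \<open>integral_atomic_law\<close>, which makes
  the two expectations comparable term by term.\<close>

lemma (in prob_space) expectation_finite_indep:
  fixes X :: "'i \<Rightarrow> 'a \<Rightarrow> nat" and G :: "('i \<Rightarrow> nat) \<Rightarrow> real"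
  assumes I: "finite I" "I \<noteq> {}" and ind: "indep_vars (\<lambda>_. count_space UNIV) X I"
    and bnd: "\<And>j \<omega>. j \<in> I \<Longrightarrow> X j \<omega> \<le> N" and out: "\<And>j \<omega>. j \<notin> I \<Longrightarrow> X j \<omega> = 0"
  shows "(\<lambda>\<omega>. G (\<lambda>j. X j \<omega>)) \<in> borel_measurable M"
    and "expectation (\<lambda>\<omega>. G (\<lambda>j. X j \<omega>)) =
      (\<Sum>\<kappa>\<in>PiE_dflt I 0 (\<lambda>_. {..N}). G \<kappa> * (\<Prod>j\<in>I. prob {\<omega> \<in> space M. X j \<omega> = \<kappa> j}))"
proof -
  let ?X = "PiE_dflt I 0 (\<lambda>_. {..N})"
  define E where "E \<kappa> = (\<Inter>j\<in>I. X j -` {\<kappa> j} \<inter> space M)" for \<kappa>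
  have fin: "finite ?X" using I by (intro finite_PiE_dflt) auto
  have Xm: "X j \<in> M \<rightarrow>\<^sub>M count_space UNIV" if "j \<in> I" for j
    using ind that by (simp add: indep_vars_def)
  have E: "E \<kappa> \<in> events" for \<kappa>
    unfolding E_def using I measurable_sets[OF Xm] by (intro sets.finite_INT) auto
  have eq: "G (\<lambda>j. X j \<omega>) = (\<Sum>\<kappa>\<in>?X. G \<kappa> * indicator (E \<kappa>) \<omega>)" if "\<omega> \<in> space M" for \<omega>
  proof -
    have "indicator (E \<kappa>) \<omega> = (if \<kappa> = (\<lambda>j. X j \<omega>) then 1 else (0::real))" if "\<kappa> \<in> ?X" for \<kappa>
    proof -
      have "\<omega> \<in> E \<kappa> \<longleftrightarrow> (\<forall>j\<in>I. \<kappa> j = X j \<omega>)"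
        using \<open>\<omega> \<in> space M\<close> I(2) by (auto simp: E_def)
      moreover have "\<kappa> j = X j \<omega>" if "j \<notin> I" for j
        using that out[OF that] \<open>\<kappa> \<in> ?X\<close> by (simp add: PiE_dflt_def)
      ultimately have "\<omega> \<in> E \<kappa> \<longleftrightarrow> \<kappa> = (\<lambda>j. X j \<omega>)" by (metis (no_types))
      then show ?thesis by (simp add: indicator_def)
    qed
    then have "(\<Sum>\<kappa>\<in>?X. G \<kappa> * indicator (E \<kappa>) \<omega>) = (\<Sum>\<kappa>\<in>?X. if \<kappa> = (\<lambda>j. X j \<omega>) then G \<kappa> else 0)"
      by (intro sum.cong) auto
    moreover have "(\<lambda>j. X j \<omega>) \<in> ?X" using bnd out by (auto simp: PiE_dflt_def)
    ultimately show ?thesis using fin by simp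
  qed
  have "(\<lambda>\<omega>. \<Sum>\<kappa>\<in>?X. G \<kappa> * indicator (E \<kappa>) \<omega>) \<in> borel_measurable M"
    using E by (intro borel_measurable_sum borel_measurable_times borel_measurable_indicator) auto
  then show "(\<lambda>\<omega>. G (\<lambda>j. X j \<omega>)) \<in> borel_measurable M"
    by (subst measurable_cong[OF eq])
  have "expectation (\<lambda>\<omega>. G (\<lambda>j. X j \<omega>)) = expectation (\<lambda>\<omega>. \<Sum>\<kappa>\<in>?X. G \<kappa> * indicator (E \<kappa>) \<omega>)"
    by (rule Bochner_Integration.integral_cong) (simp_all add: eq)
  also have "\<dots> = (\<Sum>\<kappa>\<in>?X. G \<kappa> * prob (E \<kappa>))"
    using E by (subst Bochner_Integration.integral_sum) (auto intro!: integrable_real_indicator simp: less_top[symmetric])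
  also have "\<dots> = (\<Sum>\<kappa>\<in>?X. G \<kappa> * (\<Prod>j\<in>I. prob {\<omega> \<in> space M. X j \<omega> = \<kappa> j}))"
  proof (intro sum.cong refl arg_cong2[where f = "(*)"])
    fix \<kappa>
    have "prob (E \<kappa>) = (\<Prod>j\<in>I. prob (X j -` {\<kappa> j} \<inter> space M))"
      unfolding E_def by (rule indep_varsD_finite[OF ind I(2,1)]) auto
    also have "\<dots> = (\<Prod>j\<in>I. prob {\<omega> \<in> space M. X j \<omega> = \<kappa> j})"
      by (intro prod.cong refl arg_cong[where f = prob]) auto
    finally show "prob (E \<kappa>) = (\<Prod>j\<in>I. prob {\<omega> \<in> space M. X j \<omega> = \<kappa> j})" .
  qed
  finally show "expectation (\<lambda>\<omega>. G (\<lambda>j. X j \<omega>)) =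
      (\<Sum>\<kappa>\<in>?X. G \<kappa> * (\<Prod>j\<in>I. prob {\<omega> \<in> space M. X j \<omega> = \<kappa> j}))" .
qed

lemma ex_dense_sequence:
  obtains d :: "nat \<Rightarrow> 'a::polish_space" where "\<And>x \<delta>. \<delta> > 0 \<Longrightarrow> \<exists>i. dist x (d i) < \<delta>"
proof -
  obtain D :: "'a set" where D: "countable D" "\<And>X. open X \<Longrightarrow> X \<noteq> {} \<Longrightarrow> \<exists>d\<in>D. d \<in> X"
    by (rule countable_dense_setE) blast
  have "D \<noteq> {}" using D(2)[of UNIV] by auto
  with D(1) have r: "range (from_nat_into D) = D" by (intro range_from_nat_into)
  show thesis
  proof (rule that[of "from_nat_into D"])
    fix x :: 'a and \<delta> :: real assume "\<delta> > 0"
    then obtain y where "y \<in> D" "y \<in> ball x \<delta>" using D(2)[of "ball x \<delta>"] by auto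
    with r show "\<exists>i. dist x (from_nat_into D i) < \<delta>" by (metis imageE mem_ball)
  qed
qed

lemma indep_vars_quantized_mass:
  assumes \<xi>: "independently_scattered P \<xi>"
  shows "prob_space.indep_vars P (\<lambda>_. count_space UNIV) (\<lambda>j \<omega>. quantized_mass d n (\<xi> \<omega>) j) {..n}"
proof -
  interpret prob_space P using \<xi> by (simp add: independently_scattered_def random_measure_def)
  have "indep_vars (\<lambda>_. borel :: real measure) (\<lambda>j \<omega>. measure (\<xi> \<omega>) (nearest_cell d n j)) UNIV"
    using \<xi> nearest_cell_bounded_borel disjoint_nearest_cell unfolding independently_scattered_def by blast
  then have "indep_vars (\<lambda>_. borel :: real measure) (\<lambda>j \<omega>. measure (\<xi> \<omega>) (nearest_cell d n j)) {..n}"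
    by (rule indep_vars_subset) simp
  then have "indep_vars (\<lambda>_. count_space UNIV)
      (\<lambda>j \<omega>. (\<lambda>x. if j \<le> n then min (n * 2 ^ n) (nat \<lfloor>2 ^ n * x\<rfloor>) else 0) (measure (\<xi> \<omega>) (nearest_cell d n j))) {..n}"
    by (rule indep_vars_compose2) measurable
  then show ?thesis by (simp add: quantized_mass_def)
qed

theorem theorem8p5:
  fixes P :: "'w measure" and \<xi> :: "'w \<Rightarrow> 'a::polish_space measure"
  assumes "independently_scattered P \<xi>"
  shows "\<exists>(Q :: nat \<Rightarrow> 'a measure measure) (\<eta> :: nat \<Rightarrow> 'a measure \<Rightarrow> 'a measure).
           (\<forall>n. qid_random_measure (Q n) (\<eta> n)) \<and> vd_converges Q \<eta> P \<xi>"
proof -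
  interpret prob_space P using assms by (simp add: independently_scattered_def random_measure_def)
  have \<xi>m: "\<xi> \<in> P \<rightarrow>\<^sub>M vague_borel" using assms by (simp add: independently_scattered_def random_measure_def)
  obtain d :: "nat \<Rightarrow> 'a" where dense: "\<And>x \<delta>. \<delta> > 0 \<Longrightarrow> \<exists>i. dist x (d i) < \<delta>"
    by (rule ex_dense_sequence) blast
  define N h where "N n = n * 2 ^ n" and "h n = 1 / (2::real) ^ n" for n :: nat
  define p where "p n j k = prob {\<omega> \<in> space P. quantized_mass d n (\<xi> \<omega>) j = k}" for n j k
  \<comment> \<open>The \<open>\<ell>\<^sup>1\<close> distance between the joint law of the quantized masses and a product of laws \<open>q j\<close>.\<close>
  define dist_prod where "dist_prod n q = (\<Sum>\<kappa>\<in>PiE_dflt {..n} 0 (\<lambda>_. {..N n}).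
    \<bar>(\<Prod>j\<in>{..n}. p n j (\<kappa> j)) - (\<Prod>j\<in>{..n}. pmf (q j) (\<kappa> j))\<bar>)" for n and q :: "nat \<Rightarrow> nat pmf"
  have h: "h n > 0" for n by (simp add: h_def)
  have qN: "quantized_mass d n \<mu> j \<le> N n" for n \<mu> j by (simp add: quantized_mass_def N_def)
  have qm: "(\<lambda>\<omega>. quantized_mass d n (\<xi> \<omega>) j) \<in> P \<rightarrow>\<^sub>M count_space UNIV" if "j \<in> {..n}" for n j
    using indep_vars_quantized_mass[OF assms, of d n] that by (simp add: indep_vars_def)
  have sum_p: "(\<Sum>k\<le>N n. p n j k) = 1" if "j \<in> {..n}" for n j
  proof -
    have "(\<Sum>k\<le>N n. p n j k) = prob (\<Union>k\<in>{..N n}. {\<omega> \<in> space P. quantized_mass d n (\<xi> \<omega>) j = k})"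
      unfolding p_def using qm[OF that]
      by (intro finite_measure_finite_Union[symmetric]) (auto simp: disjoint_family_on_def)
    also have "(\<Union>k\<in>{..N n}. {\<omega> \<in> space P. quantized_mass d n (\<xi> \<omega>) j = k}) = space P"
      using qN by auto
    finally show ?thesis by (simp add: prob_space)
  qed
  have "\<exists>q. (\<forall>j\<in>{..n}. set_pmf (q j) \<subseteq> {..N n}) \<and>
      (\<forall>j\<in>{..n}. \<forall>z. norm z = 1 \<longrightarrow> (\<Sum>k\<le>N n. complex_of_real (pmf (q j) k) * z ^ k) \<noteq> 0) \<and>
      dist_prod n q < 1 / real (Suc n)" for n
  proof (rule exponential_tilt_approximation[where I = "{..n}" and p = "p n" and N = "N n" and \<epsilon> = "1 / real (Suc n)"])
    show "0 \<le> p n j k" for j k by (simp add: p_def)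
    show "(\<Sum>k\<le>N n. p n j k) = 1" if "j \<in> {..n}" for j using that by (rule sum_p)
    fix q :: "nat \<Rightarrow> nat pmf"
    assume supp: "\<And>j. j \<in> {..n} \<Longrightarrow> set_pmf (q j) \<subseteq> {..N n}"
      and nz: "\<And>j z. j \<in> {..n} \<Longrightarrow> norm z = 1 \<Longrightarrow> (\<Sum>k\<le>N n. complex_of_real (pmf (q j) k) * z ^ k) \<noteq> 0"
      and close: "(\<Sum>\<kappa>\<in>PiE_dflt {..n} 0 (\<lambda>_. {..N n}).
        \<bar>(\<Prod>j\<in>{..n}. p n j (\<kappa> j)) - (\<Prod>j\<in>{..n}. pmf (q j) (\<kappa> j))\<bar>) < 1 / real (Suc n)"
    show "\<exists>q. (\<forall>j\<in>{..n}. set_pmf (q j) \<subseteq> {..N n}) \<and>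
      (\<forall>j\<in>{..n}. \<forall>z. norm z = 1 \<longrightarrow> (\<Sum>k\<le>N n. complex_of_real (pmf (q j) k) * z ^ k) \<noteq> 0) \<and>
      dist_prod n q < 1 / real (Suc n)"
      using close unfolding dist_prod_def[symmetric]
      by (intro exI[of _ q] conjI ballI allI impI supp nz)
  qed simp_all
  then obtain q where q: "\<And>n j. j \<in> {..n} \<Longrightarrow> set_pmf (q n j) \<subseteq> {..N n}"
    and nz: "\<And>n j z. j \<in> {..n} \<Longrightarrow> norm z = 1 \<Longrightarrow> (\<Sum>k\<le>N n. complex_of_real (pmf (q n j) k) * z ^ k) \<noteq> 0"
    and dp: "\<And>n. dist_prod n (q n) < 1 / real (Suc n)"
    by metis
  define Q where "Q n = measure_pmf (atomic_law d n (h n) (q n))" for n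
  have "qid_random_measure (Q n) to_locally_finite" for n
    unfolding Q_def by (rule qid_random_measure_atomic_law[OF h q nz])
  moreover have "vd_converges Q (\<lambda>_. to_locally_finite) P \<xi>"
    unfolding vd_converges_def
  proof (intro allI impI)
    fix g :: "'a measure \<Rightarrow> real"
    assume g: "continuous_map vague_topology euclideanreal g \<and> bounded (g ` topspace vague_topology)"
    then obtain C where C: "\<And>\<mu>. \<mu> \<in> locally_finite_measures \<Longrightarrow> \<bar>g \<mu>\<bar> \<le> C"
      unfolding bounded_iff topspace_vague_topology by auto
    let ?A = "\<lambda>n \<kappa>. atomic_measure d n (\<lambda>j. h n * real (\<kappa> j))"
    let ?K = "\<lambda>n \<omega> j. quantized_mass d n (\<xi> \<omega>) j"
    have A: "?A n \<kappa> \<in> locally_finite_measures" for n and \<kappa> :: "nat \<Rightarrow> nat"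
      using h[of n] by (intro atomic_measure_locally_finite) simp
    have out: "quantized_mass d n \<mu> j = 0" if "j \<notin> {..n}" for n \<mu> j using that by (simp add: quantized_mass_def)
    note quant = expectation_finite_indep[OF finite_atMost _ indep_vars_quantized_mass[OF assms] qN out,
      where G = "\<lambda>\<kappa>. g (?A n \<kappa>)" for n]
    have gm: "(\<lambda>\<omega>. g (?A n (?K n \<omega>))) \<in> borel_measurable P" for n
      by (rule quant(1)) auto
    have ge: "expectation (\<lambda>\<omega>. g (?A n (?K n \<omega>))) =
        (\<Sum>\<kappa>\<in>PiE_dflt {..n} 0 (\<lambda>_. {..N n}). g (?A n \<kappa>) * (\<Prod>j\<in>{..n}. p n j (\<kappa> j)))" for n
      unfolding p_def by (rule quant(2)) auto
    have lf: "\<xi> \<omega> \<in> locally_finite_measures" if "\<omega> \<in> space P" for \<omega>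
      using measurable_space[OF \<xi>m that] by (simp add: space_vague_borel)
    have quantized: "(\<lambda>n. expectation (\<lambda>\<omega>. g (?A n (?K n \<omega>)))) \<longlonglongrightarrow> expectation (\<lambda>\<omega>. g (\<xi> \<omega>))"
    proof (rule integral_dominated_convergence[where w = "\<lambda>_. C"])
      show "(\<lambda>\<omega>. g (\<xi> \<omega>)) \<in> borel_measurable P"
        using g by (intro measurable_compose[OF \<xi>m] vague_continuous_measurable) blast
      show "AE \<omega> in P. (\<lambda>n. g (?A n (?K n \<omega>))) \<longlonglongrightarrow> g (\<xi> \<omega>)"
      proof (rule AE_I2)
        fix \<omega> assume "\<omega> \<in> space P"
        then have "limitin vague_topology (\<lambda>n. ?A n (?K n \<omega>)) (\<xi> \<omega>) sequentially"
          using quantized_mass_limitin[OF dense lf] by (simp add: h_def)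
        then have "limitin euclideanreal (g \<circ> (\<lambda>n. ?A n (?K n \<omega>))) (g (\<xi> \<omega>)) sequentially"
          by (rule continuous_map_limit[OF conjunct1[OF g]])
        then show "(\<lambda>n. g (?A n (?K n \<omega>))) \<longlonglongrightarrow> g (\<xi> \<omega>)" by (simp add: comp_def)
      qed
    qed (use gm C A in auto)
    have tilted: "(\<lambda>n. (\<integral>\<mu>. g (to_locally_finite \<mu>) \<partial>Q n) - expectation (\<lambda>\<omega>. g (?A n (?K n \<omega>)))) \<longlonglongrightarrow> 0"
    proof (rule Lim_null_comparison)
      have "norm ((\<integral>\<mu>. g (to_locally_finite \<mu>) \<partial>Q n) - expectation (\<lambda>\<omega>. g (?A n (?K n \<omega>)))) \<le> \<bar>C\<bar> * (1 / real (Suc n))" for n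
      proof -
        let ?X = "PiE_dflt {..n} 0 (\<lambda>_. {..N n})"
        have "norm ((\<integral>\<mu>. g (to_locally_finite \<mu>) \<partial>Q n) - expectation (\<lambda>\<omega>. g (?A n (?K n \<omega>)))) =
            \<bar>\<Sum>\<kappa>\<in>?X. g (?A n \<kappa>) * ((\<Prod>j\<in>{..n}. pmf (q n j) (\<kappa> j)) - (\<Prod>j\<in>{..n}. p n j (\<kappa> j)))\<bar>"
          unfolding Q_def ge by (subst integral_atomic_law[OF h q]) (simp_all add: sum_subtractf right_diff_distrib)
        also have "\<dots> \<le> (\<Sum>\<kappa>\<in>?X. \<bar>g (?A n \<kappa>) * ((\<Prod>j\<in>{..n}. pmf (q n j) (\<kappa> j)) - (\<Prod>j\<in>{..n}. p n j (\<kappa> j)))\<bar>)"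
          by (rule sum_abs)
        also have "\<dots> \<le> (\<Sum>\<kappa>\<in>?X. \<bar>C\<bar> * \<bar>(\<Prod>j\<in>{..n}. p n j (\<kappa> j)) - (\<Prod>j\<in>{..n}. pmf (q n j) (\<kappa> j))\<bar>)"
        proof (rule sum_mono)
          fix \<kappa> :: "nat \<Rightarrow> nat"
          have C': "\<bar>g (?A n \<kappa>)\<bar> \<le> \<bar>C\<bar>" using C[OF A[of n \<kappa>]] by linarith
          show "\<bar>g (?A n \<kappa>) * ((\<Prod>j\<in>{..n}. pmf (q n j) (\<kappa> j)) - (\<Prod>j\<in>{..n}. p n j (\<kappa> j)))\<bar> \<le>
              \<bar>C\<bar> * \<bar>(\<Prod>j\<in>{..n}. p n j (\<kappa> j)) - (\<Prod>j\<in>{..n}. pmf (q n j) (\<kappa> j))\<bar>"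
            unfolding abs_mult abs_minus_commute[of "\<Prod>j\<in>{..n}. pmf (q n j) (\<kappa> j)"]
            by (rule mult_right_mono[OF C' abs_ge_zero])
        qed
        also have "\<dots> = \<bar>C\<bar> * dist_prod n (q n)" by (simp add: dist_prod_def sum_distrib_left)
        also have "\<dots> \<le> \<bar>C\<bar> * (1 / real (Suc n))" using dp[of n] by (intro mult_left_mono) auto
        finally show ?thesis .
      qed
      then show "\<forall>\<^sub>F n in sequentially. norm ((\<integral>\<mu>. g (to_locally_finite \<mu>) \<partial>Q n) - expectation (\<lambda>\<omega>. g (?A n (?K n \<omega>)))) \<le> \<bar>C\<bar> * (1 / real (Suc n))"
        by simp
      show "(\<lambda>n. \<bar>C\<bar> * (1 / real (Suc n))) \<longlonglongrightarrow> 0"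
        using tendsto_mult_right_zero[OF LIMSEQ_inverse_real_of_nat, of "\<bar>C\<bar>"] by (simp add: inverse_eq_divide)
    qed
    show "(\<lambda>n. \<integral>\<mu>. g (to_locally_finite \<mu>) \<partial>Q n) \<longlonglongrightarrow> (\<integral>\<omega>. g (\<xi> \<omega>) \<partial>P)"
      using tendsto_add[OF tilted quantized] by (simp only: diff_add_cancel add_0_left)
  qed
  ultimately show ?thesis
    by (intro exI[of _ Q] exI[of _ "\<lambda>_. to_locally_finite"] conjI allI)
qed

end
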